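(* The permutations $(213)$ and $(132)$ are shape-Wilf-equivalent, i.e. $|S_Y(213)|=|S_Y(132)|$ for all Young diagrams $Y$. Consequently, for any $n\ge 3$ and any permutation $\tau\in S_{n-3}$, the permutations $(n-1,n-2,n,\tau)$ and $(n-2,n,n-1,\tau)$ of $\{1,\dots,n\}$ are Wilf-equivalent, i.e. $|S_N(n-1,n-2,n,\tau)|=|S_N(n-2,n,n-1,\tau)|$ for all positive integers $N$.
   Context: Permutations are written in one-line notation; $(n-1,n-2,n,\tau)$ denotes the permutation $(n-1,n-2,n,\tau(1),\dots,\tau(n-3))$, and similarly for $(n-2,n,n-1,\tau)$. A permutation $\pi\in S_N$ contains $\tau\in S_k$ if some subsequence $\pi(j_1),\dots,\pi(j_k)$ with $j_1<\dots<j_k$ is in the same relative order as $\tau(1),\dots,\tau(k)$; otherwise $\pi$ avoids $\tau$. $S_N(\tau)$ is the set of permutations in $S_N$ avoiding $\tau$. Two permutations $\tau,\sigma$ are Wilf-equivalent if $|S_N(\tau)|=|S_N(\sigma)|$ for all positive integers $N$. Young diagrams are drawn with left-justified rows of weakly decreasing lengths from top to bottom; rows are numbered from the top and columns from the left. A transversal $T$ of a Young diagram $Y$ is a filling of its cells with 0's and 1's having exactly one 1 in every row and every column of $Y$. $T$ contains $\tau\in S_k$ if there are $k$ 1's of $T$, in columns $c_1<\dots<c_k$ and rows $r_1,\dots,r_k$ respectively, such that (a) the 1 in column $c_a$ is in a strictly higher row (nearer the top) than the 1 in column $c_b$ if and only if $\tau(a)>\tau(b)$, and (b) all the rows and columns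 through these 1's intersect inside $Y$; equivalently, the cell in row $\max_j r_j$ (the lowest of these rows) and column $c_k$ belongs to $Y$. Otherwise $T$ avoids $\tau$. $S_Y(\tau)$ is the set of all transversals of $Y$ that avoid $\tau$. Two permutations $\tau$ and $\sigma$ are shape-Wilf-equivalent if $|S_Y(\tau)|=|S_Y(\sigma)|$ for all Young diagrams $Y$. *)

theory Defs
  imports "HOL-Library.FuncSet" "HOL-Combinatorics.Multiset_Permutations"
begin

text \<open>A permutation of \<open>{1..n}\<close> is the list of its values (one-line notation). List positions, and
  the rows and columns of Young diagrams, are counted from 0.\<close>

abbreviation perms :: "nat \<Rightarrow> nat list set" where
  "perms n \<equiv> permutations_of_set {1..n}"

definition perm_contains :: "nat list \<Rightarrow> nat list \<Rightarrow> bool" where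
  "perm_contains p t \<longleftrightarrow>
     (\<exists>j :: nat \<Rightarrow> nat. strict_mono_on {..<length t} j \<and> j ` {..<length t} \<subseteq> {..<length p} \<and>
       (\<forall>a < length t. \<forall>b < length t. p ! j a < p ! j b \<longleftrightarrow> t ! a < t ! b))"

definition perms_avoiding :: "nat \<Rightarrow> nat list \<Rightarrow> nat list set" where
  "perms_avoiding N t = {p \<in> perms N. \<not> perm_contains p t}"

definition Wilf_equivalent :: "nat list \<Rightarrow> nat list \<Rightarrow> bool" where
  "Wilf_equivalent t s \<longleftrightarrow> (\<forall>N \<ge> 1. card (perms_avoiding N t) = card (perms_avoiding N s))"

text \<open>A Young diagram is the list of its row lengths, from top to bottom. The empty list is the
  empty diagram.\<close>

definition young_diagram :: "nat list \<Rightarrow> bool" where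
  "young_diagram Y \<longleftrightarrow> sorted_wrt (\<ge>) Y \<and> 0 \<notin> set Y"

text \<open>The pair \<open>(r, c)\<close> is the cell in row \<open>r\<close>, counted from the top, and column \<open>c\<close>, counted from
  the left.\<close>

definition cells :: "nat list \<Rightarrow> (nat \<times> nat) set" where
  "cells Y = {(r, c). r < length Y \<and> c < Y ! r}"

text \<open>Fillings are extensional functions, so that each filling is counted once.\<close>

definition transversals :: "nat list \<Rightarrow> (nat \<times> nat \<Rightarrow> nat) set" where
  "transversals Y = {T \<in> cells Y \<rightarrow>\<^sub>E {0, 1}.
     (\<forall>r \<in> fst ` cells Y. \<exists>!c. (r, c) \<in> cells Y \<and> T (r, c) = 1) \<and>
     (\<forall>c \<in> snd ` cells Y. \<exists>!r. (r, c) \<in> cells Y \<and> T (r, c) = 1)}"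

text \<open>Row numbers increase downwards, so a smaller row number corresponds to a larger value of the
  pattern.\<close>

definition transversal_contains ::
    "nat list \<Rightarrow> (nat \<times> nat \<Rightarrow> nat) \<Rightarrow> nat list \<Rightarrow> bool" where
  "transversal_contains Y T t \<longleftrightarrow>
     (\<exists>r c :: nat \<Rightarrow> nat. strict_mono_on {..<length t} c \<and>
       (\<forall>a < length t. (r a, c a) \<in> cells Y \<and> T (r a, c a) = 1) \<and>
       (\<forall>a < length t. \<forall>b < length t. r a < r b \<longleftrightarrow> t ! a > t ! b) \<and>
       (\<forall>a < length t. \<forall>b < length t. (r a, c b) \<in> cells Y))"

definition transversals_avoiding :: "nat list \<Rightarrow> nat list \<Rightarrow> (nat \<times> nat \<Rightarrow> nat) set" where
  "transversals_avoiding Y t = {T \<in> transversals Y. \<not> transversal_contains Y T t}"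

definition shape_Wilf_equivalent :: "nat list \<Rightarrow> nat list \<Rightarrow> bool" where
  "shape_Wilf_equivalent t s \<longleftrightarrow>
     (\<forall>Y. young_diagram Y \<longrightarrow> card (transversals_avoiding Y t) = card (transversals_avoiding Y s))"

end

(* A transversal is read along the south-east boundary of the diagram, walked from the lower left to
   the upper right: columns open, rows close, and a transversal becomes a perfect matching of openers
   with later closers. Reversing the walk exchanges the patterns 132 and 213.

   Avoiding 132, as seen from the left, only constrains the order in which the open columns may be
   closed. What matters is a composition of the number of open columns: only the first column
   of each part may be closed next, and closing it merges its part with all later parts, so 132-avoiders
   are counted by paths of compositions. A symmetric bilinear form (weight) on compositions makes
   opening adjoint to closing; hence a boundary word and its reverse have equally many paths.

   For the patterns with the suffix tau, fix the set of cells having a copy of tau strictly to the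
   lower right, together with the dots outside it. The remaining dots form an arbitrary transversal of
   a Young diagram, to which the first part applies. *)

theory Submission
  imports Defs
begin

section \<open>Paths of compositions\<close>

text \<open>A closed column can play the 1 for any two open columns to its right, so these must then
  be closed from left to right: this is why parts merge. Closing offers several choices and forgets
  where parts were separated, whereas opening is a single move that adds a part of size one, so
  paths cannot simply be run backwards. The form replaces the missing inverse. Adjointness lets each
  letter of a word be carried from one argument to the other, where it appears as the opposite
  letter; pairing with the empty composition tests for equality with it, so starting and finishing
  with nothing open become the same condition. The recursion builds in adjointness for the first
  argument only; for the second it has to come from symmetry, whose proof is the computational
  heart. In this way only 132 is ever analysed, and 213 enters through the reversed walk. In the
  part on suffixes the remaining rows and columns need not be consecutive, so the count is carried
  out for regions that are Young diagrams up to such gaps.\<close>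

text \<open>A composition is listed from its last part to its first, a part of size \<open>a + 1\<close> being
  represented by \<open>a\<close>. \<open>close_last\<close> removes one element from the last part; \<open>inner_closes\<close> lists the
  other ways of closing, which merge at least two parts.\<close>

fun close_last :: "nat list \<Rightarrow> nat list" where
  "close_last [] = []"
| "close_last (0 # S) = S"
| "close_last (Suc a # S) = a # S"

fun closes :: "nat list \<Rightarrow> nat list list" where
  "closes [] = []"
| "closes [a] = [close_last [a]]"
| "closes (a # b # S) = close_last (a # b # S) # closes (Suc (a + b) # S)"

fun inner_closes :: "nat list \<Rightarrow> nat list list" where
  "inner_closes (a # b # S) = closes (Suc (a + b) # S)"
| "inner_closes _ = []"

text \<open>The recursion is forced by \<open>weight (0 # S) T = (\<Sum>T'\<leftarrow>closes T. weight S T')\<close>, the adjointness of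
  opening and closing, together with symmetry.\<close>

fun weight :: "nat list \<Rightarrow> nat list \<Rightarrow> nat" where
  "weight [] T = (if T = [] then 1 else 0)"
| "weight (0 # S) T = (\<Sum>T'\<leftarrow>closes T. weight S T')"
| "weight (Suc a # S) T = (\<Sum>T'\<leftarrow>inner_closes T. weight (a # S) T')"

section \<open>Symmetry of the form \<open>weight\<close>\<close>

lemma closes_Cons: "closes (a # S) = close_last (a # S) # inner_closes (a # S)"
  by (cases S) auto

text \<open>Merging only adds to the size of the last part, so taking out a second element
  afterwards amounts to starting with a last part that is smaller by one.\<close>

lemma map_close_last_closes: "map close_last (closes (Suc a # S)) = closes (a # S)"
  by (induction S arbitrary: a) auto

text \<open>A singleton merged into its neighbour adds one element, which the further removal takes
  out again; what is left are the closings of \<open>T\<close>.\<close>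

lemma map_close_last_inner_closes:
  "map close_last (inner_closes (0 # T)) = closes T"
  "map close_last (inner_closes (Suc b # T)) = inner_closes (b # T)"
  by (cases T; simp add: map_close_last_closes)+

text \<open>\<open>sum_list S + length S\<close> is the number of elements of the composition, as
  \<open>a\<close> stands for a part of size \<open>a + 1\<close>. It is the measure for the
  induction in \<open>weight_commute\<close>.\<close>

lemma closes_size:
  "T \<in> set (closes S) \<Longrightarrow> sum_list T + length T < sum_list S + length S"
proof (induction S arbitrary: T rule: closes.induct)
  case (2 a)
  then show ?case by (cases a) auto
next
  case (3 a b S)
  show ?case
  proof (cases "T = close_last (a # b # S)")
    case True
    then show ?thesis by (cases a) auto
  next
    case False
    then have "T \<in> set (closes (Suc (a + b) # S))"
      using "3.prems" by auto
    from "3.IH"[OF this] show ?thesis by simp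
  qed
qed simp

lemma inner_closes_size:
  "T \<in> set (inner_closes S) \<Longrightarrow> sum_list T + length T < sum_list S + length S"
  using closes_size[of T S] by (cases S) (auto simp: closes_Cons)

text \<open>Three elements in the last part leave at least two after one removal, and merging only
  enlarges it. The \<open>weight\<close> of such a result unfolds by the third equation
  alone.\<close>

lemma hd_inner_closes:
  assumes "S' \<in> set (closes (Suc (Suc a) # S))"
  obtains x P where "S' = Suc x # P"
  using assms by (induction S arbitrary: a thesis) force+

text \<open>Splitting off the closing that merges nothing leaves the kind of sum that the third
  equation of \<open>weight\<close> has, so the two recursive equations differ by one
  summand.\<close>

lemma weight_0: "weight (0 # S) T = (if T = [] then 0 else weight S (close_last T))
    + (\<Sum>T'\<leftarrow>inner_closes T. weight S T')"
  by (cases T) (auto simp: closes_Cons)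

lemma sum_list_swap:
  fixes f :: "'a \<Rightarrow> 'b \<Rightarrow> nat"
  shows "(\<Sum>x\<leftarrow>xs. \<Sum>y\<leftarrow>ys. f x y) = (\<Sum>y\<leftarrow>ys. \<Sum>x\<leftarrow>xs. f x y)"
  by (induction xs) (auto simp: sum_list_addf)

text \<open>All members of \<open>inner_closes T\<close> have a last part of size at least two, except the first one
  if \<open>T\<close> ends with two parts of size one; this causes the extra summand.\<close>

lemma sum_inner_closes:
  assumes sym: "\<And>T'. T' \<in> set (inner_closes T) \<Longrightarrow> weight s T' = weight T' s"
    and "T \<noteq> []"
  shows "(\<Sum>T'\<leftarrow>inner_closes T. weight s T') =
     (\<Sum>T'\<leftarrow>map close_last (inner_closes T). \<Sum>s'\<leftarrow>inner_closes s. weight T' s') +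
     (if s \<noteq> [] \<and> (\<exists>P. T = 0 # 0 # P) then weight (close_last (close_last T)) (close_last s) else 0)"
proof -
  \<comment> \<open>The recursion of \<open>weight\<close> is on its first argument; after the
    exchange the results of closing \<open>T\<close> can be unfolded.\<close>
  have eq: "(\<Sum>T'\<leftarrow>inner_closes T. weight s T') = (\<Sum>T'\<leftarrow>inner_closes T. weight T' s)"
    using sym by (metis (mono_tags, lifting) map_eq_conv)
  show ?thesis
  proof (cases "\<exists>P. T = 0 # 0 # P")
    case False
    have "weight T' s = (\<Sum>s'\<leftarrow>inner_closes s. weight (close_last T') s')"
      if T': "T' \<in> set (inner_closes T)" for T'
    proof -
      obtain a b P where T: "T = a # b # P"
        using T' by (cases T rule: inner_closes.cases) auto
      \<comment> \<open>Unless both parts are singletons, the merged part has at least three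
        elements before the removal.\<close>
      then obtain c where c: "a + b = Suc c"
        using False by (cases "a + b") auto
      then obtain x Q where "T' = Suc x # Q"
        using T' T by (auto elim: hd_inner_closes)
      then show ?thesis by simp
    qed
    then have "(\<Sum>T'\<leftarrow>inner_closes T. weight T' s) =
      (\<Sum>T'\<leftarrow>inner_closes T. \<Sum>s'\<leftarrow>inner_closes s. weight (close_last T') s')"
      by (metis (mono_tags, lifting) map_eq_conv)
    then show ?thesis using False eq by (simp add: o_def)
  next
    case True
    then obtain P where T: "T = 0 # 0 # P" by auto
    define I where "I = inner_closes (Suc 0 # P)"
    \<comment> \<open>Two merged singletons make a part of size two, reduced to a singleton by the
      removal; this one member falls under the second equation of \<open>weight\<close>.\<close>
    have T1: "inner_closes T = (0 # P) # I"
      using T I_def by (simp add: closes_Cons)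
    have "weight T' s = (\<Sum>s'\<leftarrow>inner_closes s. weight (close_last T') s')"
      if T': "T' \<in> set I" for T'
    proof -
      obtain b P' where P: "P = b # P'"
        using T' by (cases P) (auto simp: I_def)
      then obtain x Q where "T' = Suc x # Q"
        using T' by (auto simp: I_def elim: hd_inner_closes)
      then show ?thesis by simp
    qed
    then have "(\<Sum>T'\<leftarrow>I. weight T' s) =
      (\<Sum>T'\<leftarrow>I. \<Sum>s'\<leftarrow>inner_closes s. weight (close_last T') s')"
      by (metis (mono_tags, lifting) map_eq_conv)
    moreover have "weight (0 # P) s = (if s = [] then 0 else weight P (close_last s))
        + (\<Sum>s'\<leftarrow>inner_closes s. weight P s')"
      by (cases s) (auto simp: closes_Cons)
    ultimately show ?thesis using eq unfolding T1 by (auto simp: T o_def)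
  qed
qed

lemma weight_Nil: "weight S [] = (if S = [] then 1 else 0)"
  by (cases "(S, [] :: nat list)" rule: weight.cases) auto

text \<open>For nonempty \<open>S\<close> and \<open>T\<close>, let \<open>s\<close> and
  \<open>t\<close> arise by taking one element off the last parts. Both values reduce to the double
  sum \<open>J\<close> over the inner closings of \<open>s\<close> and \<open>t\<close>, symmetric
  by induction, plus one copy of \<open>weight s t\<close> for each of \<open>S\<close> and
  \<open>T\<close> whose last part is a singleton. The only exception is that \<open>s\<close> and
  \<open>t\<close> are both empty.\<close>

lemma weight_commute: "weight S T = weight T S"
proof (induction "sum_list S + length S + (sum_list T + length T)" arbitrary: S T rule: less_induct)
  case less
  note IH = less
  show ?case
  proof (cases "S = [] \<or> T = []")
    case True
    then show ?thesis by (auto simp: weight_Nil)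
  next
    case False
    then have ne: "S \<noteq> []" "T \<noteq> []" by auto
    have close_last_size: "sum_list (close_last X) + length (close_last X) < sum_list X + length X"
      if "X \<noteq> []" for X
      using that by (cases X rule: close_last.cases) auto
    define s t where "s = close_last S" and "t = close_last T"
    have symT: "weight s T' = weight T' s" if "T' \<in> set (inner_closes T)" for T'
      using inner_closes_size[OF that] close_last_size[OF ne(1)] unfolding s_def by (intro IH) linarith
    have symS: "weight t S' = weight S' t" if "S' \<in> set (inner_closes S)" for S'
      using inner_closes_size[OF that] close_last_size[OF ne(2)] unfolding t_def by (intro IH) linarith
    have st: "weight s t = weight t s"
      using close_last_size[OF ne(1)] close_last_size[OF ne(2)] unfolding s_def t_def by (intro IH) linarith
    have sym2: "weight s' t' = weight t' s'"
      if "s' \<in> set (inner_closes s)" "t' \<in> set (inner_closes t)" for s' t'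
      using inner_closes_size[OF that(1)] inner_closes_size[OF that(2)]
        close_last_size[OF ne(1)] close_last_size[OF ne(2)] unfolding s_def t_def by (intro IH) linarith
    define J where "J = (\<Sum>t'\<leftarrow>inner_closes t. \<Sum>s'\<leftarrow>inner_closes s. weight t' s')"
    have "J = (\<Sum>t'\<leftarrow>inner_closes t. \<Sum>s'\<leftarrow>inner_closes s. weight s' t')"
      unfolding J_def using sym2
      by (intro arg_cong[where f = sum_list] map_cong refl) auto
    also have "\<dots> = (\<Sum>s'\<leftarrow>inner_closes s. \<Sum>t'\<leftarrow>inner_closes t. weight s' t')"
      by (rule sum_list_swap)
    finally have J': "J = \<dots>" .
    have J0: "J = 0" if "s = [] \<or> t = []"
      using that by (auto simp: J_def)
    define XT where "XT = (\<Sum>T'\<leftarrow>inner_closes T. weight s T')"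
    define XS where "XS = (\<Sum>S'\<leftarrow>inner_closes S. weight t S')"
    have last_part: "weight X Y = (\<Sum>y\<leftarrow>inner_closes Y. weight (close_last X) y)
        + (if Y \<noteq> [] \<and> (\<exists>P. X = 0 # P) then weight (close_last X) (close_last Y) else 0)"
      if "X \<noteq> []" for X Y
      using that by (cases X rule: close_last.cases) (auto simp: weight_0 simp del: weight.simps(2))
    note XT = sum_inner_closes[OF symT ne(2), folded XT_def]
    note XS = sum_inner_closes[OF symS ne(1), folded XS_def]
    have XT_Suc: "XT = J" if "T = Suc b # t0" for b t0
      using XT that unfolding J_def t_def by (simp add: map_close_last_inner_closes)
    have XS_Suc: "XS = J" if "S = Suc a # s0" for a s0
      using XS that unfolding J' s_def by (simp add: map_close_last_inner_closes)
    \<comment> \<open>The inner closings of \<open>T\<close>, shrunk once more, are all closings of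
      \<open>t\<close>. The closing of \<open>t\<close> that merges nothing and the extra summand
      recombine to \<open>weight t s\<close>.\<close>
    have XT_0: "XT = (if t = [] then 0 else weight t s + J)" if "T = 0 # t"
    proof (cases t)
      case Nil
      then show ?thesis using that by (simp add: XT_def)
    next
      case (Cons b t1)
      then show ?thesis
        using XT last_part[of t s] that unfolding J_def
        by (simp add: map_close_last_inner_closes closes_Cons)
    qed
    have XS_0: "XS = (if s = [] then 0 else weight s t + J)" if "S = 0 # s"
    proof (cases s)
      case Nil
      then show ?thesis using that by (simp add: XS_def)
    next
      case (Cons a s1)
      then show ?thesis
        using XS last_part[of s t] that unfolding J'
        by (simp add: map_close_last_inner_closes closes_Cons)
    qed
    have S: "weight S T = (if \<exists>P. S = 0 # P then weight s t else 0) + XT"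
      using last_part[OF ne(1), of T] ne(2) unfolding XT_def s_def t_def by auto
    have T: "weight T S = (if \<exists>P. T = 0 # P then weight t s else 0) + XS"
      using last_part[OF ne(2), of S] ne(1) unfolding XS_def s_def t_def by auto
    consider a s0 b t0 where "S = Suc a # s0" "T = Suc b # t0"
      | b t0 where "S = 0 # s" "T = Suc b # t0" "t \<noteq> []"
      | a s0 where "S = Suc a # s0" "T = 0 # t" "s \<noteq> []"
      | "S = 0 # s" "T = 0 # t"
      using ne unfolding s_def t_def
      by (cases S rule: close_last.cases; cases T rule: close_last.cases) auto
    then show ?thesis
    proof cases
      case 1
      then show ?thesis using S T XS_Suc XT_Suc by simp
    next
      case 2
      then show ?thesis using S T XT_Suc XS_0 J0 by (cases s) auto
    next
      case 3
      then show ?thesis using S T XS_Suc XT_0 J0 st by (cases t) auto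
    next
      case 4
      then show ?thesis using S T XS_0 XT_0 J0 st by (cases s; cases t) (auto simp: weight_Nil)
    qed
  qed
qed

text \<open>In a word, \<open>True\<close> is an opener and \<open>False\<close> a closer.\<close>

fun paths :: "bool list \<Rightarrow> (nat list \<Rightarrow> nat) \<Rightarrow> nat list \<Rightarrow> nat" where
  "paths [] f S = f S"
| "paths (True # w) f S = paths w f (0 # S)"
| "paths (False # w) f S = (\<Sum>T\<leftarrow>closes S. paths w f T)"

text \<open>\<open>weight []\<close> is the indicator of the empty composition, so the paths counted
  here are those that end with nothing open.\<close>

abbreviation completions :: "bool list \<Rightarrow> nat list \<Rightarrow> nat" where
  "completions w \<equiv> paths w (weight [])"

lemma paths_Nil [simp]: "paths [] f = f"
  by auto

lemma paths_append: "paths (u @ v) f S = paths u (paths v f) S"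
  by (induction u f S rule: paths.induct) (auto cong: map_cong)

lemma paths_sum: "paths u (\<lambda>S. \<Sum>x\<leftarrow>xs. f x S) S = (\<Sum>x\<leftarrow>xs. paths u (f x) S)"
proof (induction u "\<lambda>_ :: nat list. 0 :: nat" S rule: paths.induct)
  case (3 w S)
  then have "paths (False # w) (\<lambda>S. \<Sum>x\<leftarrow>xs. f x S) S =
      (\<Sum>T\<leftarrow>closes S. \<Sum>x\<leftarrow>xs. paths w (f x) T)"
    by (simp cong: map_cong)
  also have "\<dots> = (\<Sum>x\<leftarrow>xs. \<Sum>T\<leftarrow>closes S. paths w (f x) T)"
    by (rule sum_list_swap)
  finally show ?case by simp
qed auto

text \<open>Letters cross the form one at a time, the last one first: an opener becomes a closer by
  the second equation of \<open>weight\<close>, a closer becomes an opener by symmetry.\<close>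

lemma paths_weight:
  "paths u (\<lambda>S. weight S T) [] = completions (rev (map Not u)) T"
proof (induction u arbitrary: T rule: rev_induct)
  case (snoc x u)
  show ?case
  proof (cases x)
    case True
    have "paths [x] (\<lambda>S. weight S T) = (\<lambda>S. \<Sum>T'\<leftarrow>closes T. weight S T')"
      using True by auto
    then have "paths (u @ [x]) (\<lambda>S. weight S T) [] = paths u (\<lambda>S. \<Sum>T'\<leftarrow>closes T. weight S T') []"
      by (simp add: paths_append)
    also have "\<dots> = (\<Sum>T'\<leftarrow>closes T. paths u (\<lambda>S. weight S T') [])"
      by (rule paths_sum)
    finally show ?thesis using True snoc by simp
  next
    case False
    have "(\<Sum>S'\<leftarrow>closes S. weight S' T) = weight S (0 # T)" for S
      unfolding weight_commute[of S] by (simp add: weight_commute[of _ T])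
    then have "paths [x] (\<lambda>S. weight S T) = (\<lambda>S. weight S (0 # T))"
      using False by auto
    then have "paths (u @ [x]) (\<lambda>S. weight S T) [] = paths u (\<lambda>S. weight S (0 # T)) []"
      by (simp add: paths_append)
    then show ?thesis using False snoc by simp
  qed
qed simp

text \<open>For \<open>T = []\<close> the function \<open>weight _ T\<close> is again the indicator
  of the empty composition, so both sides count paths from empty to empty.\<close>

theorem completions_reverse: "completions w [] = completions (rev (map Not w)) []"
proof -
  have "weight [] = (\<lambda>S. weight S [])"
    by (auto simp: weight_Nil)
  then show ?thesis using paths_weight[of w "[]"] by simp
qed

section \<open>Matchings avoiding 132\<close>

definition perfect_matching :: "'a set \<Rightarrow> 'b set \<Rightarrow> ('a \<times> 'b) set \<Rightarrow> bool" where
  "perfect_matching A B M \<longleftrightarrow> M \<subseteq> A \<times> B \<and>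
     (\<forall>a\<in>A. \<exists>!b. (a, b) \<in> M) \<and> (\<forall>b\<in>B. \<exists>!a. (a, b) \<in> M)"

lemma perfect_matchingD:
  assumes "perfect_matching A B M"
  shows "(a, b) \<in> M \<Longrightarrow> a \<in> A" "(a, b) \<in> M \<Longrightarrow> b \<in> B"
    "(a, b) \<in> M \<Longrightarrow> (a', b) \<in> M \<Longrightarrow> a = a'" "(a, b) \<in> M \<Longrightarrow> (a, b') \<in> M \<Longrightarrow> b = b'"
    "a \<in> A \<Longrightarrow> \<exists>b. (a, b) \<in> M" "b \<in> B \<Longrightarrow> \<exists>a. (a, b) \<in> M"
  using assms unfolding perfect_matching_def by blast+

lemma perfect_matchingI:
  assumes "\<And>a b. (a, b) \<in> M \<Longrightarrow> a \<in> A \<and> b \<in> B"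
    and "\<And>a a' b. (a, b) \<in> M \<Longrightarrow> (a', b) \<in> M \<Longrightarrow> a = a'"
    and "\<And>a b b'. (a, b) \<in> M \<Longrightarrow> (a, b') \<in> M \<Longrightarrow> b = b'"
    and "\<And>a. a \<in> A \<Longrightarrow> \<exists>b. (a, b) \<in> M" and "\<And>b. b \<in> B \<Longrightarrow> \<exists>a. (a, b) \<in> M"
  shows "perfect_matching A B M"
  unfolding perfect_matching_def
proof (intro conjI ballI)
  show "M \<subseteq> A \<times> B" using assms(1) by auto
  show "\<exists>!b. (a, b) \<in> M" if "a \<in> A" for a using assms(3,4) that by blast
  show "\<exists>!a. (a, b) \<in> M" if "b \<in> B" for b using assms(2,5) that by blast
qed

lemma perfect_matching_insert:
  assumes M: "perfect_matching A B M" and "x \<notin> A" "y \<notin> B"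
  shows "perfect_matching (insert x A) (insert y B) (insert (x, y) M)"
proof (rule perfect_matchingI)
  show "\<exists>b. (a, b) \<in> insert (x, y) M" if "a \<in> insert x A" for a
    using that perfect_matchingD(5)[OF M, of a] by auto
  show "\<exists>a. (a, b) \<in> insert (x, y) M" if "b \<in> insert y B" for b
    using that perfect_matchingD(6)[OF M, of b] by auto
qed (use assms perfect_matchingD(1-4)[OF M] in auto)

lemma perfect_matching_remove:
  assumes M: "perfect_matching A B M" and "(x, y) \<in> M"
  shows "perfect_matching (A - {x}) (B - {y}) (M - {(x, y)})"
proof (rule perfect_matchingI)
  show "\<exists>b. (a, b) \<in> M - {(x, y)}" if "a \<in> A - {x}" for a
    using that perfect_matchingD(5)[OF M, of a] by auto
  show "\<exists>a. (a, b) \<in> M - {(x, y)}" if "b \<in> B - {y}" for b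
    using that perfect_matchingD(6)[OF M, of b] by auto
qed (use assms(2) perfect_matchingD(1-4)[OF M] in auto)

text \<open>Closers are met from the lowest row upwards, so an earlier closer is a smaller value.
  \<open>x3 < y1\<close> says that the last column opens before the lowest row closes: the cell
  where they cross lies in the diagram.\<close>

definition avoids_132 :: "(nat \<times> nat) set \<Rightarrow> bool" where
  "avoids_132 M \<longleftrightarrow> (\<nexists>x1 x2 x3 y1 y2 y3. (x1, y1) \<in> M \<and> (x2, y2) \<in> M \<and> (x3, y3) \<in> M \<and>
     x1 < x2 \<and> x2 < x3 \<and> x3 < y1 \<and> y1 < y3 \<and> y3 < y2)"

definition avoids_213 :: "(nat \<times> nat) set \<Rightarrow> bool" where
  "avoids_213 M \<longleftrightarrow> (\<nexists>x1 x2 x3 y1 y2 y3. (x1, y1) \<in> M \<and> (x2, y2) \<in> M \<and> (x3, y3) \<in> M \<and>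
     x1 < x2 \<and> x2 < x3 \<and> x3 < y2 \<and> y2 < y1 \<and> y1 < y3)"

definition increasing_on :: "nat set \<Rightarrow> (nat \<times> nat) set \<Rightarrow> bool" where
  "increasing_on P M \<longleftrightarrow>
     (\<forall>x\<in>P. \<forall>y\<in>P. \<forall>c d. x < y \<longrightarrow> (x, c) \<in> M \<longrightarrow> (y, d) \<in> M \<longrightarrow> c < d)"

lemma increasing_on_mono:
  "increasing_on P M \<Longrightarrow> M' \<subseteq> M \<Longrightarrow> P' \<subseteq> P \<Longrightarrow> increasing_on P' M'"
  unfolding increasing_on_def by blast

lemma increasing_on_Diff:
  "increasing_on (P - A) M \<Longrightarrow> increasing_on P (M - A \<times> UNIV)"
  unfolding increasing_on_def by blast

text \<open>Matchings of the part of a word from position \<open>k\<close> onwards, \<open>X\<close> being the set of openers. The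
  openers before \<open>k\<close> that are still open are those in \<open>B\<close>, a list of blocks from right to left; the
  openers in a block must be closed from left to right.\<close>

definition open_matchings :: "nat set \<Rightarrow> nat \<Rightarrow> nat \<Rightarrow> nat list list \<Rightarrow> (nat \<times> nat) set set" where
  "open_matchings X N k B = {M. perfect_matching (set (concat B) \<union> X \<inter> {k..<N}) ({k..<N} - X) M \<and>
     (\<forall>(x, y) \<in> M. x < y) \<and> avoids_132 M \<and> (\<forall>b \<in> set B. increasing_on (set b) M)}"

section \<open>Blocks of open columns and the moves between them\<close>

definition push :: "'a list \<Rightarrow> 'a list list \<Rightarrow> 'a list list" where
  "push xs B = (if xs = [] then B else xs # B)"

text \<open>Any two open columns to the right of the closed one must from now on close from left to
  right, so the rest of its block and all blocks to the right of it become one. Blocks are listed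
  from right to left, hence \<open>b @ a\<close> is increasing and its head is the head of
  \<open>b\<close>; \<open>push\<close> drops an exhausted block.\<close>

fun pops :: "'a list list \<Rightarrow> ('a \<times> 'a list list) list" where
  "pops [] = []"
| "pops [a] = [(hd a, push (tl a) [])]"
| "pops (a # b # B) = (hd a, push (tl a) (b # B)) # pops ((b @ a) # B)"

abbreviation sizes :: "'a list list \<Rightarrow> nat list" where
  "sizes \<equiv> map (\<lambda>b. length b - 1)"

lemma sizes_push: "xs \<noteq> [] \<Longrightarrow> sizes (push (tl xs) B) = close_last (sizes (xs # B))"
  by (cases xs; cases "tl xs") (auto simp: push_def)

text \<open>The link to compositions: the available moves depend on the lengths of the blocks, not
  on the columns in them.\<close>

lemma sizes_pops:
  "[] \<notin> set B \<Longrightarrow> map (\<lambda>(x, B'). sizes B') (pops B) = closes (sizes B)"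
proof (induction B rule: pops.induct)
  case (2 a)
  then show ?case using sizes_push[of a "[]"] by auto
next
  case (3 a b B)
  then have "length (b @ a) - 1 = Suc (length a - 1 + (length b - 1))"
    by (cases a; cases b) auto
  with 3 show ?case using sizes_push[of a "b # B"] by auto
qed simp

text \<open>A case distinction on \<open>L\<close>, with a predicate \<open>Q\<close> so that
  rewriting can peel off one block at a time.\<close>

lemma ex_Cons_eq_append:
  "(\<exists>L xs R. b # B = L @ (x # xs) # R \<and> Q L xs R) \<longleftrightarrow>
    (\<exists>xs. b = x # xs \<and> Q [] xs B) \<or> (\<exists>L xs R. B = L @ (x # xs) # R \<and> Q (b # L) xs R)"
  (is "?l \<longleftrightarrow> ?r")
proof
  assume ?l
  then obtain L xs R where *: "b # B = L @ (x # xs) # R" "Q L xs R"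
    by blast
  then show ?r by (cases L) auto
next
  assume ?r
  then show ?l
  proof
    assume "\<exists>xs. b = x # xs \<and> Q [] xs B"
    then show ?l by (metis append_Nil)
  next
    assume "\<exists>L xs R. B = L @ (x # xs) # R \<and> Q (b # L) xs R"
    then show ?l by (metis append_Cons)
  qed
qed

text \<open>\<open>L\<close> holds the blocks to the right of that of \<open>x\<close>, which are
  merged; \<open>R\<close> holds those to the left, which stay as they are.\<close>

lemma set_pops:
  assumes "[] \<notin> set B"
  shows "(x, B') \<in> set (pops B) \<longleftrightarrow>
    (\<exists>L xs R. B = L @ (x # xs) # R \<and> B' = push (xs @ concat (rev L)) R)"
  using assms
proof (induction B rule: pops.induct)
  case (2 a)
  then show ?case by (subst ex_Cons_eq_append) (cases a; auto)
next
  case (3 a b B)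
  obtain y a' where a: "a = y # a'" using 3 by (cases a) auto
  obtain z b' where b: "b = z # b'" using 3 by (cases b) auto
  have IH: "(x, B') \<in> set (pops ((b @ a) # B)) \<longleftrightarrow>
      (\<exists>L xs R. (b @ a) # B = L @ (x # xs) # R \<and> B' = push (xs @ concat (rev L)) R)"
    by (rule "3.IH") (use "3.prems" in auto)
  show ?case
    unfolding pops.simps set_simps insert_iff IH
    by (simp only: ex_Cons_eq_append) (auto simp: a b)
qed simp

text \<open>Reversing the list gives the columns from left to right, so the blocks are consecutive
  stretches of the open columns.\<close>

definition open_blocks :: "nat \<Rightarrow> nat list list \<Rightarrow> bool" where
  "open_blocks k B \<longleftrightarrow> [] \<notin> set B \<and> sorted_wrt (<) (concat (rev B)) \<and> (\<forall>x \<in> set (concat B). x < k)"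

lemma concat_push:
  "concat (rev (push xs B)) = concat (rev B) @ xs"
  "set (concat (push xs B)) = set xs \<union> set (concat B)"
  by (auto simp: push_def)

lemma set_push: "[] \<notin> set B \<Longrightarrow> [] \<notin> set (push xs B)"
  by (auto simp: push_def)

lemma open_blocks_pop:
  fixes xs :: "nat list"
  assumes B: "B = L @ (x # xs) # R" and B': "B' = push (xs @ concat (rev L)) R"
    and "open_blocks k B"
  shows "open_blocks (Suc k) B'"
    and "set (concat B) = insert x (set (concat B'))"
    and "x \<notin> set (concat B')"
    and "\<And>y. y \<in> set (xs @ concat (rev L)) \<longleftrightarrow> y \<in> set (concat B) \<and> x < y"
proof -
  have sorted: "sorted_wrt (<) (concat (rev R) @ x # (xs @ concat (rev L)))"
    and ne: "[] \<notin> set R" and less: "\<forall>y \<in> set (concat B). y < k"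
    using assms(3) by (auto simp: open_blocks_def B)
  show *: "set (concat B) = insert x (set (concat B'))"
    unfolding B B' concat_push(2) by auto
  show "x \<notin> set (concat B')"
    using sorted unfolding B' concat_push by (auto simp: sorted_wrt_append)
  show "open_blocks (Suc k) B'"
  proof -
    have "sorted_wrt (<) (concat (rev B'))"
      using sorted unfolding B' concat_push by (simp add: sorted_wrt_append)
    moreover have "\<forall>y \<in> set (concat B'). y < Suc k"
      using less unfolding * by (meson insertCI less_SucI)
    ultimately show ?thesis
      using ne unfolding open_blocks_def B' by (simp add: set_push)
  qed
  show "y \<in> set (xs @ concat (rev L)) \<longleftrightarrow> y \<in> set (concat B) \<and> x < y" for y
  proof -
    have "set (concat B) = set (concat (rev R)) \<union> {x} \<union> set (xs @ concat (rev L))"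
      by (auto simp: B)
    moreover have "\<forall>y \<in> set (concat (rev R)). y < x" "\<forall>y \<in> set (xs @ concat (rev L)). x < y"
      using sorted unfolding sorted_wrt_append sorted_wrt.simps by auto
    moreover have "y \<in> Q \<longleftrightarrow> y \<in> S \<and> x < y"
      if "S = P \<union> {x} \<union> Q" "\<forall>y \<in> P. y < x" "\<forall>y \<in> Q. x < y" for S P Q :: "nat set"
      using that by auto
    ultimately show ?thesis by blast
  qed
qed

text \<open>No column has been closed since \<open>k\<close> opened, so \<open>k\<close> is under no
  constraint yet, and a singleton block imposes none.\<close>

lemma open_matchings_push: "k \<in> X \<Longrightarrow> k < N \<Longrightarrow> open_matchings X N k B = open_matchings X N (Suc k) ([k] # B)"
proof -
  assume "k \<in> X" "k < N"
  then have "X \<inter> {k..<N} = insert k (X \<inter> {Suc k..<N})" "{k..<N} - X = {Suc k..<N} - X"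
    by (auto simp: Suc_le_eq order.order_iff_strict)
  then show ?thesis
    unfolding open_matchings_def by (simp add: increasing_on_def)
qed

lemma open_matchings_finish: "open_matchings X N N B = (if concat B = [] then {{}} else {})"
  unfolding open_matchings_def perfect_matching_def
  by (cases "concat B")
    (auto simp: avoids_132_def increasing_on_def simp del: set_concat concat_eq_Nil_conv)

text \<open>All closers in \<open>M\<close> exceed \<open>k\<close>, so in a new 132 the pair
  \<open>(x, k)\<close> could only be the 1. The other two columns would be open at
  \<open>k\<close>, to the right of \<open>x\<close> and closed from right to left, against the
  order in the merged block. In its old block \<open>x\<close> is the least column and gets the
  least closer.\<close>

lemma insert_open_matchings:
  assumes "open_blocks k B" "(x, B') \<in> set (pops B)" "k \<notin> X" "k < N" "M \<in> open_matchings X N (Suc k) B'"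
  shows "insert (x, k) M \<in> open_matchings X N k B" "(x, k) \<notin> M"
proof -
  obtain L xs R where B: "B = L @ (x # xs) # R" "B' = push (xs @ concat (rev L)) R"
    using assms(1,2) by (auto simp: set_pops open_blocks_def)
  define C where "C = xs @ concat (rev L)"
  note st = open_blocks_pop[OF B assms(1)]
  have less: "\<forall>y \<in> set (concat B). y < k"
    using assms(1) by (simp add: open_blocks_def)
  have eqs: "set (concat B) \<union> X \<inter> {k..<N} = insert x (set (concat B') \<union> X \<inter> {Suc k..<N})"
    "{k..<N} - X = insert k ({Suc k..<N} - X)"
    using st(2) assms(3,4) by (auto simp: Suc_le_eq order.order_iff_strict)
  have M: "perfect_matching (set (concat B') \<union> X \<inter> {Suc k..<N}) ({Suc k..<N} - X) M"
    "\<forall>(x, y) \<in> M. x < y" "avoids_132 M" "\<forall>b \<in> set B'. increasing_on (set b) M"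
    using assms(5) by (auto simp: open_matchings_def)
  have x: "x \<notin> set (concat B') \<union> X \<inter> {Suc k..<N}" "x < k"
    using st less by auto
  have gt: "k < c" if "(a, c) \<in> M" for a c
    using perfect_matchingD(2)[OF M(1) that] by auto
  then show "(x, k) \<notin> M" by blast
  have nx: "a \<noteq> x" if "(a, c) \<in> M" for a c
    using perfect_matchingD(1)[OF M(1) that] x(1) by auto
  have C: "increasing_on (set C) M"
  proof (cases "C = []")
    case False
    then have "C \<in> set B'" by (simp add: B(2) C_def[symmetric] push_def)
    then show ?thesis using M(4) by blast
  qed (simp add: increasing_on_def)
  have C_iff: "y \<in> set C \<longleftrightarrow> y \<in> set (concat B) \<and> x < y" for y
    using st(4) unfolding C_def by blast
  have "avoids_132 (insert (x, k) M)"
    unfolding avoids_132_def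
  proof clarify
    fix x1 x2 x3 y1 y2 y3
    assume in_M: "(x1, y1) \<in> insert (x, k) M" "(x2, y2) \<in> insert (x, k) M" "(x3, y3) \<in> insert (x, k) M"
      and less: "x1 < x2" "x2 < x3" "x3 < y1" "y1 < y3" "y3 < y2"
    show False
    proof (cases "y1 = k")
      case True
      then have *: "x1 = x" "(x2, y2) \<in> M" "(x3, y3) \<in> M"
        using in_M less gt by auto
      moreover have "x2 \<in> set (concat B)" "x3 \<in> set (concat B)"
        using perfect_matchingD(1)[OF M(1) *(2)] perfect_matchingD(1)[OF M(1) *(3)] less True st(2)
        by auto
      ultimately have "x2 \<in> set C" "x3 \<in> set C"
        using less C_iff by auto
      then show False
        using C * less unfolding increasing_on_def by (meson less_asym)
    next
      case False
      moreover have "k < y1"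
        using in_M(1) False gt by auto
      ultimately have "(x1, y1) \<in> M" "(x2, y2) \<in> M" "(x3, y3) \<in> M"
        using in_M less by auto
      then show False using M(3) less unfolding avoids_132_def by blast
    qed
  qed
  moreover have "increasing_on (set b) (insert (x, k) M)" if b: "b \<in> set B" for b
  proof -
    have "increasing_on (set b) M \<and> (\<forall>y \<in> set b. x \<le> y \<or> x \<notin> set b)"
    proof (cases "b \<in> set R")
      case True
      moreover have "x \<notin> set b"
        using True st(3) unfolding B(2) concat_push by auto
      ultimately show ?thesis using M(4) B(2) by (auto simp: push_def split: if_splits)
    next
      case False
      then have b: "set b \<subseteq> insert x (set C)"
        using b unfolding B(1) C_def by auto
      then have "x \<le> y" if "y \<in> set b" for y
        using that C_iff by (auto simp: less_imp_le)
      moreover have "increasing_on (set b) (M - {x} \<times> UNIV)"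
        using b by (intro increasing_on_Diff increasing_on_mono[OF C]) auto
      moreover have "M - {x} \<times> UNIV = M" using nx by auto
      ultimately show ?thesis by simp
    qed
    then have M: "increasing_on (set b) M" and x: "x \<in> set b \<Longrightarrow> y \<in> set b \<Longrightarrow> x \<le> y" for y
      by auto
    show ?thesis
      unfolding increasing_on_def
    proof (intro ballI allI impI)
      fix y z c d
      assume yz: "y \<in> set b" "z \<in> set b" "y < z" "(y, c) \<in> insert (x, k) M" "(z, d) \<in> insert (x, k) M"
      have "z \<noteq> x" using x[of y] yz by auto
      then have z: "(z, d) \<in> M" using yz(5) by blast
      show "c < d"
      proof (cases "(y, c) \<in> M")
        case True
        then show ?thesis using M yz z unfolding increasing_on_def by blast
      next
        case False
        then show ?thesis using gt[OF z] yz(4) by simp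
      qed
    qed
  qed
  ultimately show "insert (x, k) M \<in> open_matchings X N k B"
    unfolding open_matchings_def eqs
    using perfect_matching_insert[OF M(1) x(1), of k] M(2) x(2) by auto
qed

text \<open>The partner of \<open>k\<close> heads its block, since an earlier member would have to
  close before \<open>k\<close>, where no closer is left. Two open columns to the right of the
  partner that close in decreasing order would form a 132 with it.\<close>

lemma remove_open_matchings:
  assumes "open_blocks k B" "k \<notin> X" "k < N" "M \<in> open_matchings X N k B"
  obtains x B' where "(x, B') \<in> set (pops B)" "(x, k) \<in> M" "M - {(x, k)} \<in> open_matchings X N (Suc k) B'"
proof -
  have M: "perfect_matching (set (concat B) \<union> X \<inter> {k..<N}) ({k..<N} - X) M"
    "\<forall>(x, y) \<in> M. x < y" "avoids_132 M" "\<forall>b \<in> set B. increasing_on (set b) M"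
    using assms(4) by (auto simp: open_matchings_def)
  have less: "\<forall>y \<in> set (concat B). y < k"
    using assms(1) by (simp add: open_blocks_def)
  obtain x where x: "(x, k) \<in> M"
    using perfect_matchingD(6)[OF M(1), of k] assms by auto
  then have "x \<in> set (concat B)" and xk: "x < k"
    using perfect_matchingD(1)[OF M(1) x] M(2) by auto
  then obtain b where b: "b \<in> set B" "x \<in> set b" by auto
  obtain y xs where yxs: "b = y # xs"
    using b(2) by (cases b) auto
  obtain L R where "B = L @ b # R" using b by (meson split_list)
  then have Beq: "B = L @ (y # xs) # R" using yxs by simp
  have "y = x"
  proof (rule ccontr)
    assume "y \<noteq> x"
    moreover have "sorted_wrt (<) (y # xs)"
      using assms(1) unfolding open_blocks_def Beq by (auto simp: sorted_wrt_append)
    ultimately have "y < x" using b(2) yxs by auto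
    moreover obtain c where c: "(y, c) \<in> M"
      using perfect_matchingD(5)[OF M(1), of y] unfolding Beq by auto
    ultimately have "c < k"
      using M(4) b x yxs unfolding increasing_on_def by (meson list.set_intros(1))
    then show False using perfect_matchingD(2)[OF M(1) c] by auto
  qed
  define B' where "B' = push (xs @ concat (rev L)) R"
  have B: "B = L @ (x # xs) # R" using Beq \<open>y = x\<close> by simp
  note st = open_blocks_pop[OF B B'_def assms(1)]
  have pop: "(x, B') \<in> set (pops B)"
    using assms(1) B B'_def by (auto simp: set_pops open_blocks_def)
  have eqs: "set (concat B') \<union> X \<inter> {Suc k..<N} = (set (concat B) \<union> X \<inter> {k..<N}) - {x}"
    "{Suc k..<N} - X = ({k..<N} - X) - {k}"
    using st(2,3) assms(2,3) xk by (auto simp: Suc_le_eq order.order_iff_strict)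
  let ?M = "M - {(x, k)}"
  have "increasing_on (set b) ?M" if b: "b \<in> set B'" for b
  proof (cases "b \<in> set R")
    case True
    then have "increasing_on (set b) M" using M(4) B by simp
    then show ?thesis by (rule increasing_on_mono) auto
  next
    case False
    then have b: "b = xs @ concat (rev L)"
      using b unfolding B'_def by (auto simp: push_def split: if_splits)
    show ?thesis unfolding increasing_on_def
    proof (intro ballI allI impI, rule ccontr)
      fix y z c d
      assume yz: "y \<in> set b" "z \<in> set b" "y < z" "(y, c) \<in> ?M" "(z, d) \<in> ?M" "\<not> c < d"
      then have "c \<noteq> d" using perfect_matchingD(3)[OF M(1), of y c z] by auto
      then have "d < c" using yz by simp
      have "x < y" "z < k"
        using yz st(4) less unfolding b by blast+
      moreover have "k \<noteq> d"
        using yz(5) perfect_matchingD(3)[OF M(1) x, of z] by auto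
      then have "k < d"
        using perfect_matchingD(2)[OF M(1), of z d] yz(5) by auto
      ultimately show False
        using M(3) x yz \<open>d < c\<close> unfolding avoids_132_def by blast
    qed
  qed
  moreover have "avoids_132 ?M"
    using M(3) unfolding avoids_132_def by blast
  ultimately have "?M \<in> open_matchings X N (Suc k) B'"
    unfolding open_matchings_def eqs using perfect_matching_remove[OF M(1) x] M(2) by auto
  then show thesis using that pop x by blast
qed

text \<open>Makes the partner of the closer \<open>k\<close> identify the move, so that the classes
  in \<open>card_open_matchings\<close> are disjoint.\<close>

lemma distinct_pops: "[] \<notin> set B \<Longrightarrow> distinct (concat B) \<Longrightarrow> distinct (map fst (pops B))"
proof (induction B rule: pops.induct)
  case (3 a b B)
  have "fst ` set (pops ((b @ a) # B)) \<subseteq> set (concat (b # B))"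
  proof
    fix x assume "x \<in> fst ` set (pops ((b @ a) # B))"
    then obtain B' where "(x, B') \<in> set (pops ((b @ a) # B))" by force
    then have "\<exists>L xs R. (b @ a) # B = L @ (x # xs) # R"
      using set_pops[of "(b @ a) # B" x B'] 3 by auto
    then obtain L xs R where "(b @ a) # B = L @ (x # xs) # R" by blast
    then show "x \<in> set (concat (b # B))"
      using 3 by (cases L; cases b) auto
  qed
  then have "hd a \<notin> fst ` set (pops ((b @ a) # B))"
    using 3 by (cases a) auto
  with 3 show ?case by auto
qed auto

lemma finite_open_matchings: "finite (open_matchings X N k B)"
proof (rule finite_subset)
  show "open_matchings X N k B \<subseteq> Pow ((set (concat B) \<union> X \<inter> {k..<N}) \<times> ({k..<N} - X))"
    by (auto simp: open_matchings_def perfect_matching_def)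
qed auto

lemma card_open_matchings:
  assumes "open_blocks k B" "k \<le> N"
  shows "card (open_matchings X N k B) = completions (map (\<lambda>i. i \<in> X) [k..<N]) (sizes B)"
  using assms
proof (induction "N - k" arbitrary: k B)
  case 0
  then have "k = N" by simp
  \<comment> \<open>As blocks are nonempty, nothing is open exactly for the empty composition, where
    \<open>weight []\<close> is 1.\<close>
  moreover have "concat B = [] \<longleftrightarrow> B = []"
    using 0 by (cases B) (auto simp: open_blocks_def)
  ultimately show ?case by (simp add: open_matchings_finish)
next
  case (Suc d)
  then have k: "k < N" and d: "d = N - Suc k" by auto
  then have upt: "[k..<N] = k # [Suc k..<N]" by (simp add: upt_conv_Cons)
  show ?case
  proof (cases "k \<in> X")
    case True
    have "open_blocks (Suc k) ([k] # B)"
      using Suc.prems by (auto simp: open_blocks_def sorted_wrt_append less_Suc_eq)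
    from Suc.hyps(1)[OF d this] show ?thesis
      using k True by (simp add: open_matchings_push upt)
  next
    case False
    have ne: "[] \<notin> set B" using Suc.prems by (simp add: open_blocks_def)
    have "distinct (concat (rev B))"
      using Suc.prems strict_sorted_iff unfolding open_blocks_def by blast
    then have "distinct (concat B)"
      by (metis mset_concat mset_eq_imp_distinct_iff mset_rev rev_map sum_mset_sum_list)
    with ne have dist: "distinct (map fst (pops B))" by (rule distinct_pops)
    let ?F = "\<lambda>(x, B'). insert (x, k) ` open_matchings X N (Suc k) B'"
    have "open_matchings X N k B = (\<Union>p\<in>set (pops B). ?F p)"
    proof safe
      fix M assume "M \<in> open_matchings X N k B"
      then obtain x B' where *: "(x, B') \<in> set (pops B)" "(x, k) \<in> M" "M - {(x, k)} \<in> open_matchings X N (Suc k) B'"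
        using remove_open_matchings Suc.prems(1) False k by metis
      moreover have "M = insert (x, k) (M - {(x, k)})" using * by auto
      ultimately show "M \<in> (\<Union>p\<in>set (pops B). ?F p)" by blast
    qed (use insert_open_matchings Suc.prems(1) False k in blast)
    also have "card \<dots> = (\<Sum>p\<in>set (pops B). card (?F p))"
    proof (rule card_UN_disjoint)
      show "\<forall>p\<in>set (pops B). \<forall>q\<in>set (pops B). p \<noteq> q \<longrightarrow> ?F p \<inter> ?F q = {}"
      proof (intro ballI impI)
        fix p q assume pq: "p \<in> set (pops B)" "q \<in> set (pops B)" "p \<noteq> q"
        obtain x P y Q where xy: "p = (x, P)" "q = (y, Q)" by fastforce
        have "x \<noteq> y"
          using dist pq xy by (metis eq_key_imp_eq_value)
        {
          fix M assume "M \<in> ?F p" "M \<in> ?F q"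
          then have M: "M \<in> open_matchings X N k B" "(x, k) \<in> M" "(y, k) \<in> M"
            using insert_open_matchings(1)[OF Suc.prems(1) _ False k] pq xy by auto
          then have "perfect_matching (set (concat B) \<union> X \<inter> {k..<N}) ({k..<N} - X) M"
            by (simp add: open_matchings_def)
          then have False using M perfect_matchingD(3) \<open>x \<noteq> y\<close> by metis
        }
        then show "?F p \<inter> ?F q = {}" by blast
      qed
    qed (auto intro: finite_open_matchings)
    also have "\<dots> = (\<Sum>p\<in>set (pops B). completions (map (\<lambda>i. i \<in> X) [Suc k..<N]) (sizes (snd p)))"
    proof (rule sum.cong)
      fix p assume p: "p \<in> set (pops B)"
      obtain x B' where xB: "p = (x, B')" by fastforce
      have "inj_on (insert (x, k)) (open_matchings X N (Suc k) B')"
        using insert_open_matchings(2)[OF Suc.prems(1) _ False k, of x B'] p xB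
        by (intro inj_onI) (metis insert_ident)
      moreover obtain L xs R where "B = L @ (x # xs) # R" "B' = push (xs @ concat (rev L)) R"
        using set_pops[OF ne] p xB by blast
      then have "open_blocks (Suc k) B'"
        using open_blocks_pop(1) Suc.prems(1) by blast
      ultimately show "card (?F p) = completions (map (\<lambda>i. i \<in> X) [Suc k..<N]) (sizes (snd p))"
        using Suc.hyps(1)[OF d, of B'] k by (simp add: xB card_image)
    qed simp
    also have "\<dots> = (\<Sum>p\<leftarrow>pops B. completions (map (\<lambda>i. i \<in> X) [Suc k..<N]) (sizes (snd p)))"
      using dist by (subst sum_list_distinct_conv_sum_set) (auto simp: distinct_map)
    also have "\<dots> = (\<Sum>S\<leftarrow>map (\<lambda>(x, B'). sizes B') (pops B). completions (map (\<lambda>i. i \<in> X) [Suc k..<N]) S)"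
      by (simp add: o_def split_def)
    also have "\<dots> = completions (map (\<lambda>i. i \<in> X) [k..<N]) (sizes B)"
      unfolding sizes_pops[OF ne] upt using False by simp
    finally show ?thesis .
  qed
qed

section \<open>Reversal of the boundary walk\<close>

lemma swap_image_iff:
  assumes "inj_on f A" "inj_on g B" "M \<subseteq> A \<times> B" "a \<in> A" "b \<in> B"
  shows "(g b, f a) \<in> (\<lambda>(a, b). (g b, f a)) ` M \<longleftrightarrow> (a, b) \<in> M"
  using assms by (force dest: inj_onD)

lemma perfect_matching_swap:
  assumes f: "inj_on f A" and g: "inj_on g B" and M: "M \<subseteq> A \<times> B"
  shows "perfect_matching (g ` B) (f ` A) ((\<lambda>(a, b). (g b, f a)) ` M) \<longleftrightarrow> perfect_matching A B M"
    (is "perfect_matching _ _ ?M \<longleftrightarrow> _")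
proof
  note iff = swap_image_iff[OF f g M]
  assume *: "perfect_matching (g ` B) (f ` A) ?M"
  show "perfect_matching A B M"
  proof (rule perfect_matchingI)
    show AB: "a \<in> A \<and> b \<in> B" if "(a, b) \<in> M" for a b
      using that M by auto
    show "a = a'" if "(a, b) \<in> M" "(a', b) \<in> M" for a a' b
    proof -
      have "(g b, f a) \<in> ?M" "(g b, f a') \<in> ?M"
        using that by force+
      then have "f a = f a'" by (rule perfect_matchingD(4)[OF *])
      then show ?thesis using f AB that by (meson inj_onD)
    qed
    show "b = b'" if "(a, b) \<in> M" "(a, b') \<in> M" for a b b'
    proof -
      have "(g b, f a) \<in> ?M" "(g b', f a) \<in> ?M"
        using that by force+
      then have "g b = g b'" by (rule perfect_matchingD(3)[OF *])
      then show ?thesis using g AB that by (meson inj_onD)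
    qed
    show "\<exists>b. (a, b) \<in> M" if "a \<in> A" for a
      using perfect_matchingD(6)[OF *, of "f a"] that f M by (force dest: inj_onD)
    show "\<exists>a. (a, b) \<in> M" if "b \<in> B" for b
      using perfect_matchingD(5)[OF *, of "g b"] that g M by (force dest: inj_onD)
  qed
next
  assume *: "perfect_matching A B M"
  show "perfect_matching (g ` B) (f ` A) ?M"
  proof (rule perfect_matchingI)
    show "x \<in> g ` B \<and> y \<in> f ` A" if "(x, y) \<in> ?M" for x y
      using that M by auto
    show "x = x'" if xx: "(x, y) \<in> ?M" "(x', y) \<in> ?M" for x x' y
    proof -
      obtain a b a' b' where ab: "(a, b) \<in> M" "(a', b') \<in> M" "x = g b" "y = f a" "x' = g b'" "y = f a'"
        using xx by auto
      then have "a = a'" using f M by (auto dest: inj_onD)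
      then show ?thesis using ab perfect_matchingD(4)[OF *, of a b b'] by simp
    qed
    show "y = y'" if xx: "(x, y) \<in> ?M" "(x, y') \<in> ?M" for x y y'
    proof -
      obtain a b a' b' where ab: "(a, b) \<in> M" "(a', b') \<in> M" "x = g b" "y = f a" "x = g b'" "y' = f a'"
        using xx by auto
      then have "b = b'" using g M by (auto dest: inj_onD)
      then show ?thesis using ab perfect_matchingD(3)[OF *, of a b a'] by simp
    qed
    show "\<exists>y. (x, y) \<in> ?M" if x: "x \<in> g ` B" for x
    proof -
      obtain b where b: "b \<in> B" "x = g b" using x by blast
      then obtain a where "(a, b) \<in> M"
        using perfect_matchingD(6)[OF * b(1)] by blast
      with b have "(x, f a) \<in> ?M" by force
      then show ?thesis by blast
    qed
    show "\<exists>x. (x, y) \<in> ?M" if y: "y \<in> f ` A" for y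
    proof -
      obtain a where a: "a \<in> A" "y = f a" using y by blast
      then obtain b where "(a, b) \<in> M"
        using perfect_matchingD(5)[OF * a(1)] by blast
      with a have "(g b, y) \<in> ?M" by force
      then show ?thesis by blast
    qed
  qed
qed

text \<open>Serves twice: for reversing the walk, where openers and closers change roles, and for
  turning a dot, given as row and column, into a pair of opener (column) and closer (row).\<close>

lemma card_perfect_matchings_swap:
  assumes f: "inj_on f A" and g: "inj_on g B"
    and PQ: "\<And>M. perfect_matching A B M \<Longrightarrow> Q ((\<lambda>(a, b). (g b, f a)) ` M) \<longleftrightarrow> P M"
  shows "card {M. perfect_matching A B M \<and> P M} =
    card {M. perfect_matching (g ` B) (f ` A) M \<and> Q M}"
proof -
  let ?h = "\<lambda>(a, b). (g b, f a)"
  have "?h ` (A \<times> B) = g ` B \<times> f ` A" by force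
  moreover have "inj_on ?h (A \<times> B)"
    using f g by (auto intro!: inj_onI dest: inj_onD)
  ultimately have "bij_betw ?h (A \<times> B) (g ` B \<times> f ` A)"
    by (simp add: bij_betw_def)
  then have *: "bij_betw ((`) ?h) (Pow (A \<times> B)) (Pow (g ` B \<times> f ` A))"
    by (rule bij_betw_Pow)
  have "bij_betw ((`) ?h) {M \<in> Pow (A \<times> B). perfect_matching A B M \<and> P M}
     {M \<in> Pow (g ` B \<times> f ` A). perfect_matching (g ` B) (f ` A) M \<and> Q M}"
    using perfect_matching_swap[OF f g] PQ by (intro bij_betw_Collect[OF *]) auto
  moreover have "{M \<in> Pow (A \<times> B). perfect_matching A B M \<and> P M} = {M. perfect_matching A B M \<and> P M}"
    "{M \<in> Pow (g ` B \<times> f ` A). perfect_matching (g ` B) (f ` A) M \<and> Q M} =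
     {M. perfect_matching (g ` B) (f ` A) M \<and> Q M}"
    unfolding perfect_matching_def by blast+
  ultimately show ?thesis by (simp add: bij_betw_same_card)
qed

abbreviation ascending :: "(nat \<times> nat) set \<Rightarrow> bool" where
  "ascending M \<equiv> \<forall>(x, y) \<in> M. x < y"

lemma card_avoids_132:
  assumes "X \<subseteq> {0..<N}"
  shows "card {M. perfect_matching X ({0..<N} - X) M \<and> ascending M \<and> avoids_132 M} =
    completions (map (\<lambda>i. i \<in> X) [0..<N]) []"
proof -
  have "open_blocks 0 []" by (simp add: open_blocks_def)
  moreover have "open_matchings X N 0 [] =
      {M. perfect_matching X ({0..<N} - X) M \<and> ascending M \<and> avoids_132 M}"
    using assms by (simp add: open_matchings_def Int_absorb2)
  ultimately show ?thesis using card_open_matchings[of 0 "[]" N X] by simp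
qed

text \<open>Reversed, the closers of a 213 become openers, met in the order \<open>y3\<close>,
  \<open>y1\<close>, \<open>y2\<close>; their new closers, coming from \<open>x3\<close>,
  \<open>x1\<close>, \<open>x2\<close>, have ranks 1, 3, 2. The crossing condition
  \<open>x3 < y2\<close> is preserved.\<close>

lemma reverse_avoids:
  assumes "M \<subseteq> {0..<N} \<times> {0..<N}"
  shows "avoids_132 ((\<lambda>(x, y). (N - Suc y, N - Suc x)) ` M) \<longleftrightarrow> avoids_213 M"
proof -
  let ?h = "\<lambda>(x, y). (N - Suc y, N - Suc x)"
  have "\<not> avoids_132 (?h ` M)" if contains: "\<not> avoids_213 M"
  proof -
    obtain x1 x2 x3 y1 y2 y3 where *: "(x1, y1) \<in> M" "(x2, y2) \<in> M" "(x3, y3) \<in> M"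
      "x1 < x2" "x2 < x3" "x3 < y2" "y2 < y1" "y1 < y3"
      using contains unfolding avoids_213_def by blast
    then have "(N - Suc y1, N - Suc x1) \<in> ?h ` M" "(N - Suc y2, N - Suc x2) \<in> ?h ` M"
       "(N - Suc y3, N - Suc x3) \<in> ?h ` M" by force+
    moreover have "y1 < N" "y2 < N" "y3 < N" using * assms by auto
    then have "N - Suc y3 < N - Suc y1" "N - Suc y1 < N - Suc y2" "N - Suc y2 < N - Suc x3"
       "N - Suc x3 < N - Suc x2" "N - Suc x2 < N - Suc x1"
      using * by linarith+
    ultimately show ?thesis unfolding avoids_132_def by blast
  qed
  moreover have "\<not> avoids_213 M" if contains: "\<not> avoids_132 (?h ` M)"
  proof -
    obtain x1 x2 x3 y1 y2 y3 where "(x1, y1) \<in> ?h ` M" "(x2, y2) \<in> ?h ` M" "(x3, y3) \<in> ?h ` M"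
      and *: "x1 < x2" "x2 < x3" "x3 < y1" "y1 < y3" "y3 < y2"
      using contains unfolding avoids_132_def by blast
    then obtain a1 a2 a3 b1 b2 b3 where M: "(a1, b1) \<in> M" "(a2, b2) \<in> M" "(a3, b3) \<in> M"
      and eq: "x1 = N - Suc b1" "y1 = N - Suc a1" "x2 = N - Suc b2" "y2 = N - Suc a2"
        "x3 = N - Suc b3" "y3 = N - Suc a3"
      by auto
    then have "a1 < N" "a2 < N" "a3 < N" "b1 < N" "b2 < N" "b3 < N" using assms by auto
    then have "a2 < a3" "a3 < a1" "a1 < b3" "b3 < b2" "b2 < b1"
      using * unfolding eq by linarith+
    then show ?thesis using M unfolding avoids_213_def by blast
  qed
  ultimately show ?thesis by blast
qed

text \<open>\<open>X'\<close> is the set of openers of the reversed word. Reversal turns 213 into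
  132 for \<open>X'\<close>, and the number of paths is the same for both words.\<close>

theorem card_avoids_213_eq_132:
  assumes X: "X \<subseteq> {0..<N}"
  shows "card {M. perfect_matching X ({0..<N} - X) M \<and> ascending M \<and> avoids_213 M} =
    card {M. perfect_matching X ({0..<N} - X) M \<and> ascending M \<and> avoids_132 M}"
proof -
  let ?r = "\<lambda>x. N - Suc x"
  define X' where "X' = ?r ` ({0..<N} - X)"
  have inj: "inj_on ?r {0..<N}" by (auto intro!: inj_onI)
  have r_iff: "?r i \<in> ?r ` A \<longleftrightarrow> i \<in> A" if "i < N" "A \<subseteq> {0..<N}" for i A
    using inj that by (meson atLeastLessThan_iff inj_on_image_mem_iff le0)
  have rr: "?r (?r i) = i" if "i < N" for i using that by simp
  have X'_iff: "i \<in> X' \<longleftrightarrow> N - Suc i \<notin> X" if "i < N" for i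
    using r_iff[of "?r i" "{0..<N} - X"] rr[OF that] that by (auto simp: X'_def)
  have "i \<in> ?r ` X \<longleftrightarrow> N - Suc i \<in> X" if "i < N" for i
    using r_iff[of "?r i" X] rr[OF that] that X by auto
  then have rX: "?r ` X = {0..<N} - X'"
    using X'_iff X by fastforce
  have "inj_on ?r X" "inj_on ?r ({0..<N} - X)"
    using inj X by (auto intro: inj_on_subset)
  then have "card {M. perfect_matching X ({0..<N} - X) M \<and> (ascending M \<and> avoids_213 M)} =
    card {M. perfect_matching (?r ` ({0..<N} - X)) (?r ` X) M \<and> (ascending M \<and> avoids_132 M)}"
  proof (rule card_perfect_matchings_swap)
    fix M assume "perfect_matching X ({0..<N} - X) M"
    then have M: "M \<subseteq> {0..<N} \<times> {0..<N}"
      using X unfolding perfect_matching_def by blast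
    have "ascending ((\<lambda>(a, b). (?r b, ?r a)) ` M) \<longleftrightarrow> ascending M"
      using M by (force simp: diff_less_mono2)
    with reverse_avoids[OF M]
    show "ascending ((\<lambda>(a, b). (?r b, ?r a)) ` M) \<and> avoids_132 ((\<lambda>(a, b). (?r b, ?r a)) ` M)
      \<longleftrightarrow> ascending M \<and> avoids_213 M" by simp
  qed
  also have "\<dots> = completions (map (\<lambda>i. i \<in> X') [0..<N]) []"
    unfolding rX X'_def[symmetric] by (rule card_avoids_132) (auto simp: X'_def)
  also have "map (\<lambda>i. i \<in> X') [0..<N] = rev (map Not (map (\<lambda>i. i \<in> X) [0..<N]))"
    by (rule nth_equalityI) (simp_all add: X'_iff rev_nth)
  also have "completions \<dots> [] = completions (map (\<lambda>i. i \<in> X) [0..<N]) []"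
    by (rule completions_reverse[symmetric])
  also have "\<dots> = card {M. perfect_matching X ({0..<N} - X) M \<and> ascending M \<and> avoids_132 M}"
    using card_avoids_132[OF X] by simp
  finally show ?thesis .
qed

section \<open>Placements in a Young diagram\<close>

text \<open>Closure to the upper left is required only for rows and columns that the set meets, so
  gaps between them are allowed. Deleting the lines of fixed dots then needs no renumbering.\<close>

definition young_region :: "(nat \<times> nat) set \<Rightarrow> bool" where
  "young_region Y \<longleftrightarrow> finite Y \<and> (\<forall>(r, c) \<in> Y. \<forall>r' \<in> fst ` Y. \<forall>c' \<in> snd ` Y.
     r' \<le> r \<longrightarrow> c' \<le> c \<longrightarrow> (r', c') \<in> Y)"

definition placements :: "(nat \<times> nat) set \<Rightarrow> (nat \<times> nat) set set" where
  "placements Y = {M. perfect_matching (fst ` Y) (snd ` Y) M \<and> M \<subseteq> Y}"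

text \<open>The region is an argument separate from the dots: \<open>UNIV\<close> gives containment
  in a permutation, and \<open>dominated t M\<close> serves for the prefix of a longer
  pattern.\<close>

definition region_contains :: "(nat \<times> nat) set \<Rightarrow> (nat \<times> nat) set \<Rightarrow> nat list \<Rightarrow> bool" where
  "region_contains Y M t \<longleftrightarrow>
     (\<exists>r c :: nat \<Rightarrow> nat. strict_mono_on {..<length t} c \<and>
       (\<forall>a < length t. (r a, c a) \<in> M) \<and>
       (\<forall>a < length t. \<forall>b < length t. r a < r b \<longleftrightarrow> t ! a > t ! b) \<and>
       (\<forall>a < length t. \<forall>b < length t. (r a, c b) \<in> Y))"

lemma all_less_3: "(\<forall>a < 3. P a) \<longleftrightarrow> P 0 \<and> P 1 \<and> P (2 :: nat)"
  by (auto simp: numeral_eq_Suc less_Suc_eq)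

lemma strict_mono_on_3: "strict_mono_on {..<3} c \<longleftrightarrow> c 0 < c 1 \<and> c 1 < c (2 :: nat)"
  for c :: "nat \<Rightarrow> nat"
  unfolding strict_mono_on_def lessThan_iff
  by (auto simp: numeral_eq_Suc less_Suc_eq)

lemma ex_fun_3: "\<exists>r :: nat \<Rightarrow> 'a. r 0 = x \<and> r 1 = y \<and> r 2 = z"
  by (rule exI[of _ "\<lambda>i. if i = 0 then x else if i = 1 then y else z"]) simp

lemma region_contains_3:
  "region_contains Y M [s0, s1, s2] \<longleftrightarrow>
    (\<exists>r0 r1 r2 c0 c1 c2. c0 < c1 \<and> c1 < c2 \<and> (r0, c0) \<in> M \<and> (r1, c1) \<in> M \<and> (r2, c2) \<in> M \<and>
      (r0 < r1 \<longleftrightarrow> s1 < s0) \<and> (r1 < r0 \<longleftrightarrow> s0 < s1) \<and> (r0 < r2 \<longleftrightarrow> s2 < s0) \<and>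
      (r2 < r0 \<longleftrightarrow> s0 < s2) \<and> (r1 < r2 \<longleftrightarrow> s2 < s1) \<and> (r2 < r1 \<longleftrightarrow> s1 < s2) \<and>
      {r0, r1, r2} \<times> {c0, c1, c2} \<subseteq> Y)"
    (is "_ \<longleftrightarrow> (\<exists>r0 r1 r2 c0 c1 c2. ?Q r0 r1 r2 c0 c1 c2)")
proof -
  have len: "length [s0, s1, s2] = 3" by simp
  have "region_contains Y M [s0, s1, s2] \<longleftrightarrow>
      (\<exists>(r :: nat \<Rightarrow> nat) (c :: nat \<Rightarrow> nat). ?Q (r 0) (r 1) (r 2) (c 0) (c 1) (c 2))"
    unfolding region_contains_def len strict_mono_on_3 all_less_3
    by (intro arg_cong[where f = Ex] ext) auto
  also have "\<dots> \<longleftrightarrow> (\<exists>r0 r1 r2 c0 c1 c2. ?Q r0 r1 r2 c0 c1 c2)" (is "?l = ?r")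
  proof
    assume ?r
    then obtain r0 r1 r2 c0 c1 c2 where Q: "?Q r0 r1 r2 c0 c1 c2" by blast
    obtain r c :: "nat \<Rightarrow> nat" where "r 0 = r0 \<and> r 1 = r1 \<and> r 2 = r2" "c 0 = c0 \<and> c 1 = c1 \<and> c 2 = c2"
      using ex_fun_3[of r0 r1 r2] ex_fun_3[of c0 c1 c2] by blast
    with Q have "?Q (r 0) (r 1) (r 2) (c 0) (c 1) (c 2)" by simp
    then show ?l by blast
  qed blast
  finally show ?thesis .
qed


context
  fixes Y :: "(nat \<times> nat) set" and R C :: "nat set"
  assumes Y: "young_region Y"
  defines "R \<equiv> fst ` Y" and "C \<equiv> snd ` Y"
begin

text \<open>The positions of the rows and columns along the south-east boundary of the region, walked
  from the lower left to the upper right.\<close>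

definition row_pos :: "nat \<Rightarrow> nat" where
  "row_pos r = card {c \<in> C. (r, c) \<in> Y} + card {r' \<in> R. r < r'}"

definition col_pos :: "nat \<Rightarrow> nat" where
  "col_pos c = card {c' \<in> C. c' < c} + card {r \<in> R. (r, c) \<notin> Y}"

lemma finite_RC: "finite R" "finite C"
  using Y by (auto simp: young_region_def R_def C_def)

lemma Y_subset: "Y \<subseteq> R \<times> C"
  by (force simp: R_def C_def)

lemma Y_down: "(r, c) \<in> Y \<Longrightarrow> r' \<in> R \<Longrightarrow> c' \<in> C \<Longrightarrow> r' \<le> r \<Longrightarrow> c' \<le> c \<Longrightarrow> (r', c') \<in> Y"
  using Y unfolding young_region_def R_def C_def by blast

lemma col_pos_less: "c \<in> C \<Longrightarrow> c' \<in> C \<Longrightarrow> c < c' \<Longrightarrow> col_pos c < col_pos c'"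
  unfolding col_pos_def using finite_RC
  by (intro add_less_le_mono psubset_card_mono card_mono) (auto intro: Y_down)

lemma row_pos_less: "r \<in> R \<Longrightarrow> r' \<in> R \<Longrightarrow> r' < r \<Longrightarrow> row_pos r < row_pos r'"
  unfolding row_pos_def using finite_RC
  by (intro add_le_less_mono psubset_card_mono card_mono) (auto intro: Y_down)

lemma col_pos_less_iff: "c \<in> C \<Longrightarrow> c' \<in> C \<Longrightarrow> col_pos c < col_pos c' \<longleftrightarrow> c < c'"
  using col_pos_less[of c c'] col_pos_less[of c' c] by (cases c c' rule: linorder_cases) auto

lemma row_pos_less_iff: "r \<in> R \<Longrightarrow> r' \<in> R \<Longrightarrow> row_pos r < row_pos r' \<longleftrightarrow> r' < r"
  using row_pos_less[of r r'] row_pos_less[of r' r] by (cases r r' rule: linorder_cases) auto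

text \<open>Columns left of \<open>c\<close> meet row \<open>r\<close>, and rows that miss column
  \<open>c\<close> lie below \<open>r\<close>; column \<open>c\<close> itself makes the inequality
  strict. For a cell outside the region, row \<open>r\<close> plays this part in the opposite
  inequality.\<close>

lemma col_pos_less_row_pos: "(r, c) \<in> Y \<Longrightarrow> col_pos c < row_pos r"
  unfolding col_pos_def row_pos_def using finite_RC Y_subset
  by (intro add_less_le_mono psubset_card_mono card_mono)
    (auto intro: Y_down simp: not_le[symmetric])

lemma row_pos_less_col_pos:
  "r \<in> R \<Longrightarrow> c \<in> C \<Longrightarrow> (r, c) \<notin> Y \<Longrightarrow> row_pos r < col_pos c"
  unfolding col_pos_def row_pos_def using finite_RC Y_subset
  by (intro add_le_less_mono psubset_card_mono card_mono)
    (auto intro: Y_down simp: not_le[symmetric])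

lemma col_pos_less_row_pos_iff:
  "r \<in> R \<Longrightarrow> c \<in> C \<Longrightarrow> col_pos c < row_pos r \<longleftrightarrow> (r, c) \<in> Y"
  using col_pos_less_row_pos row_pos_less_col_pos by (meson less_asym)

lemma inj_col_pos: "inj_on col_pos C"
  by (rule inj_onI) (metis col_pos_less less_irrefl linorder_neqE_nat)

lemma inj_row_pos: "inj_on row_pos R"
  by (rule inj_onI) (metis row_pos_less less_irrefl linorder_neqE_nat)

text \<open>Pigeonhole: \<open>card R + card C\<close> distinct positions below that number fill the
  whole range.\<close>

lemma row_pos_image:
  "col_pos ` C \<subseteq> {0..<card R + card C}"
  "row_pos ` R = {0..<card R + card C} - col_pos ` C"
proof -
  have col: "col_pos c < card R + card C" if "c \<in> C" for c
  proof -
    have "col_pos c < card C + card R"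
      unfolding col_pos_def using finite_RC that
      by (intro add_less_le_mono psubset_card_mono card_mono) auto
    then show ?thesis by simp
  qed
  have row: "row_pos r < card R + card C" if "r \<in> R" for r
  proof -
    have "row_pos r < card C + card R"
      unfolding row_pos_def using finite_RC that
      by (intro add_le_less_mono psubset_card_mono card_mono) auto
    then show ?thesis by simp
  qed
  show "col_pos ` C \<subseteq> {0..<card R + card C}" using col by auto
  have disj: "col_pos ` C \<inter> row_pos ` R = {}"
    using col_pos_less_row_pos row_pos_less_col_pos by (fastforce dest: less_imp_neq)
  have "card (col_pos ` C \<union> row_pos ` R) = card R + card C"
    using finite_RC disj
    by (simp add: card_Un_disjoint card_image[OF inj_col_pos] card_image[OF inj_row_pos])
  then have "col_pos ` C \<union> row_pos ` R = {0..<card R + card C}"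
    using col row by (intro card_subset_eq) auto
  with disj show "row_pos ` R = {0..<card R + card C} - col_pos ` C" by blast
qed

text \<open>The cell in the lowest row and the last column of the copy forces the other eight
  crossing cells.\<close>

lemma region_contains_132:
  assumes M: "M \<subseteq> Y"
  shows "region_contains Y M [1, 3, 2] \<longleftrightarrow>
    (\<exists>r0 r1 r2 c0 c1 c2. c0 < c1 \<and> c1 < c2 \<and> (r0, c0) \<in> M \<and> (r1, c1) \<in> M \<and> (r2, c2) \<in> M \<and>
      r1 < r2 \<and> r2 < r0 \<and> (r0, c2) \<in> Y)"
  unfolding region_contains_3
proof (intro arg_cong[where f = Ex] ext)
  fix r0 r1 r2 c0 c1 c2
  have "{r0, r1, r2} \<times> {c0, c1, c2} \<subseteq> Y"
    if *: "c0 < c1" "c1 < c2" "(r0, c0) \<in> M" "(r1, c1) \<in> M" "(r2, c2) \<in> M"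
      "r1 < r2" "r2 < r0" "(r0, c2) \<in> Y"
  proof -
    have "(r, c) \<in> Y" if "r \<in> {r0, r1, r2}" "c \<in> {c0, c1, c2}" for r c
      by (rule Y_down[OF *(8)]) (use * that M Y_subset in auto)
    then show ?thesis by blast
  qed
  then show "(c0 < c1 \<and> c1 < c2 \<and> (r0, c0) \<in> M \<and> (r1, c1) \<in> M \<and> (r2, c2) \<in> M \<and>
      (r0 < r1 \<longleftrightarrow> (3 :: nat) < 1) \<and> (r1 < r0 \<longleftrightarrow> (1 :: nat) < 3) \<and> (r0 < r2 \<longleftrightarrow> (2 :: nat) < 1) \<and>
      (r2 < r0 \<longleftrightarrow> (1 :: nat) < 2) \<and> (r1 < r2 \<longleftrightarrow> (2 :: nat) < 3) \<and> (r2 < r1 \<longleftrightarrow> (3 :: nat) < 2) \<and>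
      {r0, r1, r2} \<times> {c0, c1, c2} \<subseteq> Y) \<longleftrightarrow>
    (c0 < c1 \<and> c1 < c2 \<and> (r0, c0) \<in> M \<and> (r1, c1) \<in> M \<and> (r2, c2) \<in> M \<and>
      r1 < r2 \<and> r2 < r0 \<and> (r0, c2) \<in> Y)" by auto
qed

lemma region_contains_213:
  assumes M: "M \<subseteq> Y"
  shows "region_contains Y M [2, 1, 3] \<longleftrightarrow>
    (\<exists>r0 r1 r2 c0 c1 c2. c0 < c1 \<and> c1 < c2 \<and> (r0, c0) \<in> M \<and> (r1, c1) \<in> M \<and> (r2, c2) \<in> M \<and>
      r2 < r0 \<and> r0 < r1 \<and> (r1, c2) \<in> Y)"
  unfolding region_contains_3
proof (intro arg_cong[where f = Ex] ext)
  fix r0 r1 r2 c0 c1 c2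
  have "{r0, r1, r2} \<times> {c0, c1, c2} \<subseteq> Y"
    if *: "c0 < c1" "c1 < c2" "(r0, c0) \<in> M" "(r1, c1) \<in> M" "(r2, c2) \<in> M"
      "r2 < r0" "r0 < r1" "(r1, c2) \<in> Y"
  proof -
    have "(r, c) \<in> Y" if "r \<in> {r0, r1, r2}" "c \<in> {c0, c1, c2}" for r c
      by (rule Y_down[OF *(8)]) (use * that M Y_subset in auto)
    then show ?thesis by blast
  qed
  then show "(c0 < c1 \<and> c1 < c2 \<and> (r0, c0) \<in> M \<and> (r1, c1) \<in> M \<and> (r2, c2) \<in> M \<and>
      (r0 < r1 \<longleftrightarrow> (1 :: nat) < 2) \<and> (r1 < r0 \<longleftrightarrow> (2 :: nat) < 1) \<and> (r0 < r2 \<longleftrightarrow> (3 :: nat) < 2) \<and>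
      (r2 < r0 \<longleftrightarrow> (2 :: nat) < 3) \<and> (r1 < r2 \<longleftrightarrow> (3 :: nat) < 1) \<and> (r2 < r1 \<longleftrightarrow> (1 :: nat) < 3) \<and>
      {r0, r1, r2} \<times> {c0, c1, c2} \<subseteq> Y) \<longleftrightarrow>
    (c0 < c1 \<and> c1 < c2 \<and> (r0, c0) \<in> M \<and> (r1, c1) \<in> M \<and> (r2, c2) \<in> M \<and>
      r2 < r0 \<and> r0 < r1 \<and> (r1, c2) \<in> Y)" by auto
qed

definition boundary_matching :: "(nat \<times> nat) set \<Rightarrow> (nat \<times> nat) set" where
  "boundary_matching M = (\<lambda>(r, c). (col_pos c, row_pos r)) ` M"

lemma in_boundary_matching:
  assumes "M \<subseteq> R \<times> C"
  shows "(x, y) \<in> boundary_matching M \<longleftrightarrow> (\<exists>r\<in>R. \<exists>c\<in>C. (r, c) \<in> M \<and> x = col_pos c \<and> y = row_pos r)"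
  using assms unfolding boundary_matching_def by auto

lemma ascending_boundary_matching: "M \<subseteq> R \<times> C \<Longrightarrow> ascending (boundary_matching M) \<longleftrightarrow> M \<subseteq> Y"
  using col_pos_less_row_pos_iff unfolding boundary_matching_def by fastforce

text \<open>Positions of rows grow upwards, so \<open>r1 < r2 < r0\<close> turns into
  \<open>y1 < y3 < y2\<close>, and the corner cell \<open>(r0, c2)\<close> into
  \<open>x3 < y1\<close>.\<close>

lemma avoids_132_boundary_matching:
  assumes "M \<subseteq> Y"
  shows "avoids_132 (boundary_matching M) \<longleftrightarrow> \<not> region_contains Y M [1, 3, 2]"
proof -
  have M: "M \<subseteq> R \<times> C" using assms Y_subset by blast
  have "\<not> avoids_132 (boundary_matching M) \<longleftrightarrow>
    (\<exists>r0 r1 r2 c0 c1 c2. c0 < c1 \<and> c1 < c2 \<and> (r0, c0) \<in> M \<and> (r1, c1) \<in> M \<and> (r2, c2) \<in> M \<and>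
      r1 < r2 \<and> r2 < r0 \<and> (r0, c2) \<in> Y)" (is "?l \<longleftrightarrow> ?r")
  proof
    assume ?l
    then obtain x1 x2 x3 y1 y2 y3 where
      xy: "(x1, y1) \<in> boundary_matching M" "(x2, y2) \<in> boundary_matching M" "(x3, y3) \<in> boundary_matching M"
        "x1 < x2" "x2 < x3" "x3 < y1" "y1 < y3" "y3 < y2"
      unfolding avoids_132_def by blast
    then obtain r0 c0 r1 c1 r2 c2 where rc: "(r0, c0) \<in> M" "(r1, c1) \<in> M" "(r2, c2) \<in> M"
      and eq: "x1 = col_pos c0" "y1 = row_pos r0" "x2 = col_pos c1" "y2 = row_pos r1"
        "x3 = col_pos c2" "y3 = row_pos r2"
      unfolding boundary_matching_def by auto
    moreover have "{r0, r1, r2} \<subseteq> R" "{c0, c1, c2} \<subseteq> C" using rc M by auto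
    ultimately show ?r
      using xy by (metis col_pos_less_iff row_pos_less_iff col_pos_less_row_pos_iff insert_subset)
  next
    assume ?r
    then obtain r0 r1 r2 c0 c1 c2 where
      *: "c0 < c1" "c1 < c2" "(r0, c0) \<in> M" "(r1, c1) \<in> M" "(r2, c2) \<in> M"
        "r1 < r2" "r2 < r0" "(r0, c2) \<in> Y"
      by blast
    moreover have "{r0, r1, r2} \<subseteq> R" "{c0, c1, c2} \<subseteq> C" using * M by auto
    ultimately have "(col_pos c0, row_pos r0) \<in> boundary_matching M" "(col_pos c1, row_pos r1) \<in> boundary_matching M"
      "(col_pos c2, row_pos r2) \<in> boundary_matching M" "col_pos c0 < col_pos c1" "col_pos c1 < col_pos c2"
      "col_pos c2 < row_pos r0" "row_pos r0 < row_pos r2" "row_pos r2 < row_pos r1"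
      by (auto simp: in_boundary_matching[OF M] col_pos_less_iff row_pos_less_iff col_pos_less_row_pos_iff)
    then show ?l unfolding avoids_132_def by blast
  qed
  then show ?thesis using region_contains_132[OF assms] by blast
qed

lemma avoids_213_boundary_matching:
  assumes "M \<subseteq> Y"
  shows "avoids_213 (boundary_matching M) \<longleftrightarrow> \<not> region_contains Y M [2, 1, 3]"
proof -
  have M: "M \<subseteq> R \<times> C" using assms Y_subset by blast
  have "\<not> avoids_213 (boundary_matching M) \<longleftrightarrow>
    (\<exists>r0 r1 r2 c0 c1 c2. c0 < c1 \<and> c1 < c2 \<and> (r0, c0) \<in> M \<and> (r1, c1) \<in> M \<and> (r2, c2) \<in> M \<and>
      r2 < r0 \<and> r0 < r1 \<and> (r1, c2) \<in> Y)" (is "?l \<longleftrightarrow> ?r")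
  proof
    assume ?l
    then obtain x1 x2 x3 y1 y2 y3 where
      xy: "(x1, y1) \<in> boundary_matching M" "(x2, y2) \<in> boundary_matching M" "(x3, y3) \<in> boundary_matching M"
        "x1 < x2" "x2 < x3" "x3 < y2" "y2 < y1" "y1 < y3"
      unfolding avoids_213_def by blast
    then obtain r0 c0 r1 c1 r2 c2 where rc: "(r0, c0) \<in> M" "(r1, c1) \<in> M" "(r2, c2) \<in> M"
      and eq: "x1 = col_pos c0" "y1 = row_pos r0" "x2 = col_pos c1" "y2 = row_pos r1"
        "x3 = col_pos c2" "y3 = row_pos r2"
      unfolding boundary_matching_def by auto
    moreover have "{r0, r1, r2} \<subseteq> R" "{c0, c1, c2} \<subseteq> C" using rc M by auto
    ultimately show ?r
      using xy by (metis col_pos_less_iff row_pos_less_iff col_pos_less_row_pos_iff insert_subset)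
  next
    assume ?r
    then obtain r0 r1 r2 c0 c1 c2 where
      *: "c0 < c1" "c1 < c2" "(r0, c0) \<in> M" "(r1, c1) \<in> M" "(r2, c2) \<in> M"
        "r2 < r0" "r0 < r1" "(r1, c2) \<in> Y"
      by blast
    moreover have "{r0, r1, r2} \<subseteq> R" "{c0, c1, c2} \<subseteq> C" using * M by auto
    ultimately have "(col_pos c0, row_pos r0) \<in> boundary_matching M" "(col_pos c1, row_pos r1) \<in> boundary_matching M"
      "(col_pos c2, row_pos r2) \<in> boundary_matching M" "col_pos c0 < col_pos c1" "col_pos c1 < col_pos c2"
      "col_pos c2 < row_pos r1" "row_pos r1 < row_pos r0" "row_pos r0 < row_pos r2"
      by (auto simp: in_boundary_matching[OF M] col_pos_less_iff row_pos_less_iff col_pos_less_row_pos_iff)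
    then show ?l unfolding avoids_213_def by blast
  qed
  then show ?thesis using region_contains_213[OF assms] by blast
qed

lemma card_placements:
  assumes "\<And>M. M \<subseteq> Y \<Longrightarrow> Q (boundary_matching M) \<longleftrightarrow> \<not> region_contains Y M t"
  shows "card {M \<in> placements Y. \<not> region_contains Y M t} =
    card {M. perfect_matching (col_pos ` C) ({0..<card R + card C} - col_pos ` C) M \<and>
      ascending M \<and> Q M}"
proof -
  have "{M \<in> placements Y. \<not> region_contains Y M t} =
     {M. perfect_matching R C M \<and> (M \<subseteq> Y \<and> \<not> region_contains Y M t)}"
    by (auto simp: placements_def R_def C_def)
  also have "card \<dots> = card {M. perfect_matching (col_pos ` C) (row_pos ` R) M \<and> (ascending M \<and> Q M)}"
  proof (rule card_perfect_matchings_swap[OF inj_row_pos inj_col_pos])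
    fix M assume "perfect_matching R C M"
    then have "M \<subseteq> R \<times> C" by (simp add: perfect_matching_def)
    then show "ascending ((\<lambda>(a, b). (col_pos b, row_pos a)) ` M) \<and>
        Q ((\<lambda>(a, b). (col_pos b, row_pos a)) ` M) \<longleftrightarrow> M \<subseteq> Y \<and> \<not> region_contains Y M t"
      using ascending_boundary_matching[of M] assms[of M] unfolding boundary_matching_def by blast
  qed
  finally show ?thesis by (simp add: row_pos_image(2))
qed

theorem card_placements_213_132:
  "card {M \<in> placements Y. \<not> region_contains Y M [2, 1, 3]} =
   card {M \<in> placements Y. \<not> region_contains Y M [1, 3, 2]}"
  using card_placements[of avoids_213 "[2, 1, 3]"] card_placements[of avoids_132 "[1, 3, 2]"]
    avoids_213_boundary_matching avoids_132_boundary_matching card_avoids_213_eq_132[OF row_pos_image(1)]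
  by simp

end

section \<open>Young diagrams and transversals as regions and placements\<close>

lemma young_region_cells:
  assumes "young_diagram Y"
  shows "young_region (cells Y)"
proof -
  have "cells Y = (SIGMA r : {..<length Y}. {..<Y ! r})"
    by (auto simp: cells_def)
  then have "finite (cells Y)" by simp
  moreover have "Y ! r \<le> Y ! r'" if "r' \<le> r" "r < length Y" for r r'
    using assms that sorted_wrt_nth_less[of "(\<ge>)" Y r' r]
    by (cases "r = r'") (auto simp: young_diagram_def)
  ultimately show ?thesis
    unfolding young_region_def cells_def by fastforce
qed

text \<open>Lines that meet the intersection belong to \<open>A\<close> and \<open>B\<close>, so
  closure of \<open>E\<close> is enough.\<close>

lemma young_region_Int:
  assumes "\<And>r c r' c'. (r, c) \<in> E \<Longrightarrow> r' \<le> r \<Longrightarrow> c' \<le> c \<Longrightarrow> (r', c') \<in> E"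
    and "finite A" "finite B"
  shows "young_region (E \<inter> A \<times> B)"
proof -
  have "(r', c') \<in> E \<inter> A \<times> B"
    if *: "(r, c) \<in> E \<inter> A \<times> B" "r' \<in> fst ` (E \<inter> A \<times> B)" "c' \<in> snd ` (E \<inter> A \<times> B)" "r' \<le> r" "c' \<le> c"
    for r c r' c'
    using assms(1)[of r c r' c'] * by (elim imageE IntE SigmaE) simp
  then show ?thesis
    unfolding young_region_def using assms(2,3) by blast
qed

text \<open>A filling corresponds to its set of 1's; \<open>?G\<close> inverts this because
  extensionality fixes the values off the diagram.\<close>

lemma card_transversals_avoiding:
  "card (transversals_avoiding Y t) = card {M \<in> placements (cells Y). \<not> region_contains (cells Y) M t}"
proof -
  let ?F = "\<lambda>T :: nat \<times> nat \<Rightarrow> nat. {x \<in> cells Y. T x = 1}"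
  let ?G = "\<lambda>M. \<lambda>x \<in> cells Y. if x \<in> M then 1 else 0 :: nat"
  have "bij_betw ?F (transversals Y) (placements (cells Y))"
  proof (rule bij_betw_byWitness[where f' = ?G])
    show "\<forall>T \<in> transversals Y. ?G (?F T) = T"
    proof
      fix T assume "T \<in> transversals Y"
      then have "T \<in> cells Y \<rightarrow>\<^sub>E {0, 1}" by (simp add: transversals_def)
      then show "?G (?F T) = T"
        by (intro ext) (auto simp: restrict_def PiE_def extensional_def Pi_def)
    qed
    show "\<forall>M \<in> placements (cells Y). ?F (?G M) = M"
    proof
      fix M assume "M \<in> placements (cells Y)"
      then have "M \<subseteq> cells Y" by (simp add: placements_def)
      then show "?F (?G M) = M" by auto
    qed
    show "?F ` transversals Y \<subseteq> placements (cells Y)"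
    proof (rule image_subsetI)
      fix T assume "T \<in> transversals Y"
      moreover have "cells Y \<subseteq> fst ` cells Y \<times> snd ` cells Y" by force
      ultimately show "?F T \<in> placements (cells Y)"
        unfolding transversals_def placements_def perfect_matching_def by auto
    qed
    have "?G M \<in> transversals Y" if M: "M \<in> placements (cells Y)" for M
    proof -
      have iff: "(r, c) \<in> cells Y \<and> ?G M (r, c) = 1 \<longleftrightarrow> (r, c) \<in> M" for r c
        using M by (auto simp: placements_def)
      show ?thesis
        unfolding transversals_def mem_Collect_eq iff
        using M by (auto simp: placements_def perfect_matching_def)
    qed
    then show "?G ` placements (cells Y) \<subseteq> transversals Y" by blast
  qed
  then have "bij_betw ?F {T \<in> transversals Y. \<not> transversal_contains Y T t}
      {M \<in> placements (cells Y). \<not> region_contains (cells Y) M t}"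
    by (rule bij_betw_Collect) (simp add: transversal_contains_def region_contains_def)
  then show ?thesis
    by (simp add: transversals_avoiding_def bij_betw_same_card)
qed

section \<open>Permutations\<close>

text \<open>Values from 1 to \<open>N\<close> go to rows from \<open>N - 1\<close> to 0, so that
  larger values lie higher, as in diagrams.\<close>

definition dots :: "nat list \<Rightarrow> (nat \<times> nat) set" where
  "dots p = {(length p - p ! i, i) | i. i < length p}"

lemma in_dots: "(r, c) \<in> dots p \<longleftrightarrow> c < length p \<and> r = length p - p ! c"
  by (auto simp: dots_def)

lemma permsD:
  assumes "p \<in> perms N"
  shows "length p = N" "distinct p" "set p = {1..N}" "i < N \<Longrightarrow> p ! i \<in> {1..N}"
proof -
  show *: "distinct p" "set p = {1..N}"
    using assms by (auto simp: permutations_of_set_def)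
  then show "length p = N" using distinct_card by fastforce
  then show "i < N \<Longrightarrow> p ! i \<in> {1..N}" using * nth_mem by blast
qed

lemma perm_contains_iff:
  assumes p: "p \<in> perms N"
  shows "perm_contains p t \<longleftrightarrow> region_contains UNIV (dots p) t"
proof
  have less_iff: "N - p ! i < N - p ! j \<longleftrightarrow> p ! j < p ! i" if "i < N" "j < N" for i j
    using permsD(4)[OF p that(1)] permsD(4)[OF p that(2)] by auto
  note len = permsD(1)[OF p]
  {
    assume "perm_contains p t"
    then obtain j where j: "strict_mono_on {..<length t} j" "j ` {..<length t} \<subseteq> {..<N}"
      "\<forall>a < length t. \<forall>b < length t. p ! j a < p ! j b \<longleftrightarrow> t ! a < t ! b"
      unfolding perm_contains_def len by blast
    then have jN: "j a < N" if "a < length t" for a using that by blast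
    show "region_contains UNIV (dots p) t"
      unfolding region_contains_def
      by (rule exI[of _ "\<lambda>a. N - p ! j a"], rule exI[of _ j])
        (use j jN in \<open>simp add: in_dots len less_iff\<close>)
  }
  assume "region_contains UNIV (dots p) t"
  then obtain r c where rc: "strict_mono_on {..<length t} c"
      "\<forall>a < length t. (r a, c a) \<in> dots p"
      "\<forall>a < length t. \<forall>b < length t. r a < r b \<longleftrightarrow> t ! a > t ! b"
    unfolding region_contains_def by blast
  then have "c a < N" "r a = N - p ! c a" if "a < length t" for a
    using that by (simp_all add: in_dots len)
  then show "perm_contains p t"
    unfolding perm_contains_def len using rc less_iff by (intro exI[of _ c]) auto
qed

lemma bij_betw_dots: "bij_betw dots (perms N) {M. perfect_matching {..<N} {..<N} M}"
proof (rule bij_betw_imageI)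
  show "inj_on dots (perms N)"
  proof (rule inj_onI)
    fix p q assume pq: "p \<in> perms N" "q \<in> perms N" "dots p = dots q"
    note len = permsD(1)[OF pq(1)] permsD(1)[OF pq(2)]
    show "p = q"
    proof (rule nth_equalityI)
      fix i assume "i < length p"
      then have i: "i < N" using len by simp
      then have "(N - p ! i, i) \<in> dots q" using pq(3) len in_dots by blast
      then have "N - p ! i = N - q ! i" by (simp add: in_dots len)
      then show "p ! i = q ! i"
        using permsD(4)[OF pq(1) i] permsD(4)[OF pq(2) i] by auto
    qed (simp add: len)
  qed
  have "perfect_matching {..<N} {..<N} (dots p)" if p: "p \<in> perms N" for p
  proof (rule perfect_matchingI)
    note len = permsD(1)[OF p]
    show "r \<in> {..<N} \<and> c \<in> {..<N}" if "(r, c) \<in> dots p" for r c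
      using that permsD(4)[OF p, of c] by (auto simp: in_dots len)
    show "c = c'" if "(r, c) \<in> dots p" "(r, c') \<in> dots p" for r c c'
    proof -
      have c: "c < N" "c' < N" "N - p ! c = N - p ! c'" using that by (simp_all add: in_dots len)
      then have "p ! c = p ! c'" using permsD(4)[OF p, of c] permsD(4)[OF p, of c'] by auto
      then show ?thesis using c permsD(2)[OF p] len nth_eq_iff_index_eq by blast
    qed
    show "\<exists>c. (r, c) \<in> dots p" if "r \<in> {..<N}" for r
    proof -
      have "N - r \<in> set p" using that permsD(3)[OF p] by auto
      then obtain c where "c < N" "p ! c = N - r" using len by (metis in_set_conv_nth)
      then show ?thesis using that by (intro exI[of _ c]) (simp add: in_dots len)
    qed
  qed (simp_all add: in_dots permsD(1)[OF p])
  moreover have "M \<in> dots ` perms N" if M: "perfect_matching {..<N} {..<N} M" for M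
  proof -
    obtain f where f: "\<And>c. c < N \<Longrightarrow> (f c, c) \<in> M"
      using perfect_matchingD(6)[OF M] by (metis lessThan_iff)
    have fN: "f c < N" if "c < N" for c
      using perfect_matchingD(1)[OF M f[OF that]] by simp
    define p where "p = map (\<lambda>c. N - f c) [0..<N]"
    have "inj_on (\<lambda>c. N - f c) {0..<N}"
    proof (rule inj_onI)
      fix c c' assume c: "c \<in> {0..<N}" "c' \<in> {0..<N}" "N - f c = N - f c'"
      then have "f c = f c'" using fN[of c] fN[of c'] by auto
      then show "c = c'" using perfect_matchingD(4)[OF M, of "f c" c c'] f[of c] f[of c'] c by simp
    qed
    then have "distinct p" by (simp add: p_def distinct_map)
    moreover have "set p \<subseteq> {1..N}" using fN by (auto simp: p_def Suc_le_eq)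
    moreover have "card (set p) = N" using \<open>distinct p\<close> distinct_card[of p] by (simp add: p_def)
    ultimately have p: "p \<in> perms N"
      by (simp add: permutations_of_set_def card_subset_eq)
    have "dots p = M"
    proof (rule set_eqI, clarify)
      fix r c
      have "(r, c) \<in> dots p \<longleftrightarrow> c < N \<and> r = f c"
        using fN by (auto simp: in_dots p_def less_imp_le)
      also have "\<dots> \<longleftrightarrow> (r, c) \<in> M"
        using f perfect_matchingD(2,3)[OF M] by blast
      finally show "(r, c) \<in> dots p \<longleftrightarrow> (r, c) \<in> M" .
    qed
    then show ?thesis using p by blast
  qed
  ultimately show "dots ` perms N = {M. perfect_matching {..<N} {..<N} M}" by blast
qed

lemma card_perms_avoiding:
  "card (perms_avoiding N t) = card {M. perfect_matching {..<N} {..<N} M \<and> \<not> region_contains UNIV M t}"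
proof -
  have "bij_betw dots {p \<in> perms N. \<not> perm_contains p t}
     {M \<in> {M. perfect_matching {..<N} {..<N} M}. \<not> region_contains UNIV M t}"
    by (rule bij_betw_Collect[OF bij_betw_dots]) (simp add: perm_contains_iff)
  then show ?thesis by (simp add: perms_avoiding_def bij_betw_same_card)
qed

section \<open>Splitting off the suffix of a pattern\<close>

text \<open>For empty \<open>t\<close> every cell is dominated, so this case needs no separate
  treatment.\<close>

definition dominated :: "nat list \<Rightarrow> (nat \<times> nat) set \<Rightarrow> (nat \<times> nat) set" where
  "dominated t M = {(r, c). region_contains UNIV (M \<inter> {r<..} \<times> {c<..}) t}"

lemma region_containsE:
  assumes "region_contains Y M t"
  obtains r c where "strict_mono_on {..<length t} c"
    "\<And>a. a < length t \<Longrightarrow> (r a, c a) \<in> M"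
    "\<And>a b. a < length t \<Longrightarrow> b < length t \<Longrightarrow> r a < r b \<longleftrightarrow> t ! a > t ! b"
    "\<And>a b. a < length t \<Longrightarrow> b < length t \<Longrightarrow> (r a, c b) \<in> Y"
  using assms unfolding region_contains_def by blast

lemma region_containsI:
  fixes r c :: "nat \<Rightarrow> nat"
  assumes "strict_mono_on {..<length t} c"
    and "\<And>a. a < length t \<Longrightarrow> (r a, c a) \<in> M"
    and "\<And>a b. a < length t \<Longrightarrow> b < length t \<Longrightarrow> r a < r b \<longleftrightarrow> t ! a > t ! b"
    and "\<And>a b. a < length t \<Longrightarrow> b < length t \<Longrightarrow> (r a, c b) \<in> Y"
  shows "region_contains Y M t"
  unfolding region_contains_def using assms by blast

lemma region_contains_mono:
  "region_contains Y M t \<Longrightarrow> Y \<subseteq> Y' \<Longrightarrow> M \<subseteq> M' \<Longrightarrow> region_contains Y' M' t"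
  by (erule region_containsE, rule region_containsI) blast+

lemma dominated_mono: "M \<subseteq> M' \<Longrightarrow> dominated t M \<subseteq> dominated t M'"
  unfolding dominated_def by (auto elim: region_contains_mono)

lemma dominated_down:
  "(r, c) \<in> dominated t M \<Longrightarrow> r' \<le> r \<Longrightarrow> c' \<le> c \<Longrightarrow> (r', c') \<in> dominated t M"
  unfolding dominated_def by (auto elim!: region_contains_mono)

text \<open>The entries of \<open>t\<close> are smaller and come later, so a copy of
  \<open>t\<close> lies to the lower right of every crossing cell of the copy of \<open>s\<close>.
  Conversely, domination of the lower right corner cell of a copy of \<open>s\<close> provides a
  copy of \<open>t\<close> beyond all its dots.\<close>

lemma region_contains_append:
  assumes "s \<noteq> []" and gt: "\<forall>x \<in> set s. \<forall>y \<in> set t. y < x"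
  shows "region_contains UNIV M (s @ t) \<longleftrightarrow> region_contains (dominated t M) M s"
proof
  let ?k = "length s" and ?l = "length t"
  {
    assume "region_contains UNIV M (s @ t)"
    then obtain r c where c: "strict_mono_on {..<?k + ?l} c"
      and M: "\<And>a. a < ?k + ?l \<Longrightarrow> (r a, c a) \<in> M"
      and less: "\<And>a b. a < ?k + ?l \<Longrightarrow> b < ?k + ?l \<Longrightarrow> r a < r b \<longleftrightarrow> (s @ t) ! a > (s @ t) ! b"
      by (rule region_containsE) (use length_append in auto)
    have c_less: "a < b \<Longrightarrow> b < ?k + ?l \<Longrightarrow> c a < c b" for a b
      using c by (simp add: strict_mono_on_def)
    have "(r a, c b) \<in> dominated t M" if ab: "a < ?k" "b < ?k" for a b
    proof -
      have "(r (?k + i), c (?k + i)) \<in> M \<inter> {r a<..} \<times> {c b<..}" if "i < ?l" for i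
        using M[of "?k + i"] less[of a "?k + i"] c_less[of b "?k + i"] ab that gt
        by (simp add: nth_append)
      moreover have "strict_mono_on {..<?l} (\<lambda>i. c (?k + i))"
        using c_less by (simp add: strict_mono_on_def)
      moreover have "r (?k + i) < r (?k + j) \<longleftrightarrow> t ! i > t ! j" if "i < ?l" "j < ?l" for i j
        using less[of "?k + i" "?k + j"] that by simp
      ultimately show ?thesis
        unfolding dominated_def mem_Collect_eq prod.case
        by (intro region_containsI[of _ "\<lambda>i. c (?k + i)" "\<lambda>i. r (?k + i)"] UNIV_I)
    qed
    moreover have "strict_mono_on {..<?k} c"
      using c_less by (simp add: strict_mono_on_def)
    moreover have "r a < r b \<longleftrightarrow> s ! a > s ! b" if "a < ?k" "b < ?k" for a b
      using less[of a b] that by (simp add: nth_append)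
    ultimately show "region_contains (dominated t M) M s"
      using M by (intro region_containsI[of _ c r]) simp_all
  }
  assume "region_contains (dominated t M) M s"
  then obtain r c where c: "strict_mono_on {..<?k} c"
    and M: "\<And>a. a < ?k \<Longrightarrow> (r a, c a) \<in> M"
    and less: "\<And>a b. a < ?k \<Longrightarrow> b < ?k \<Longrightarrow> r a < r b \<longleftrightarrow> s ! a > s ! b"
    and dom: "\<And>a b. a < ?k \<Longrightarrow> b < ?k \<Longrightarrow> (r a, c b) \<in> dominated t M"
    by (rule region_containsE) blast
  \<comment> \<open>As \<open>s\<close> is nonempty, its copy has a lowest row \<open>r a\<close>
    and a last column \<open>c b\<close>, which define the corner cell.\<close>
  have max: "\<exists>a < ?k. \<forall>i < ?k. f i \<le> f a" for f :: "nat \<Rightarrow> nat"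
  proof -
    have "Max (f ` {..<?k}) \<in> f ` {..<?k}"
      using assms(1) by (intro Max_in) auto
    then obtain a where "a < ?k" "f a = Max (f ` {..<?k})" by auto
    then show ?thesis by (intro exI[of _ a]) simp
  qed
  obtain a b where a: "a < ?k" "\<And>i. i < ?k \<Longrightarrow> r i \<le> r a" and b: "b < ?k" "\<And>i. i < ?k \<Longrightarrow> c i \<le> c b"
    using max[of r] max[of c] by auto
  obtain r' c' where c': "strict_mono_on {..<?l} c'"
    and M': "\<And>i. i < ?l \<Longrightarrow> (r' i, c' i) \<in> M \<and> r a < r' i \<and> c b < c' i"
    and less': "\<And>i j. i < ?l \<Longrightarrow> j < ?l \<Longrightarrow> r' i < r' j \<longleftrightarrow> t ! i > t ! j"
    using dom[OF a(1) b(1)] unfolding dominated_def mem_Collect_eq prod.case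
    by (rule region_containsE) blast
  let ?r = "\<lambda>i. if i < ?k then r i else r' (i - ?k)"
  let ?c = "\<lambda>i. if i < ?k then c i else c' (i - ?k)"
  have less_r': "r i < r' j" if "i < ?k" "j < ?l" for i j
    using a(2)[OF that(1)] M'[OF that(2)] by linarith
  have less_c': "c i < c' j" if "i < ?k" "j < ?l" for i j
    using b(2)[OF that(1)] M'[OF that(2)] by linarith
  have "strict_mono_on {..<length (s @ t)} ?c"
  proof (rule strict_mono_onI)
    fix i j assume ij: "i \<in> {..<length (s @ t)}" "j \<in> {..<length (s @ t)}" "i < j"
    then show "?c i < ?c j"
      using strict_mono_onD[OF c, of i j] strict_mono_onD[OF c', of "i - ?k" "j - ?k"]
        less_c'[of i "j - ?k"] by auto
  qed
  moreover have "(?r i, ?c i) \<in> M" if "i < length (s @ t)" for i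
    using M M' that by auto
  moreover have "?r i < ?r j \<longleftrightarrow> (s @ t) ! i > (s @ t) ! j"
    if "i < length (s @ t)" "j < length (s @ t)" for i j
  proof -
    have st: "t ! j < s ! i" if "i < ?k" "j < ?l" for i j
      using gt that by simp
    consider "i < ?k" "j < ?k" | "i < ?k" "\<not> j < ?k" "j - ?k < ?l"
      | "\<not> i < ?k" "j < ?k" "i - ?k < ?l" | "\<not> i < ?k" "\<not> j < ?k" "i - ?k < ?l" "j - ?k < ?l"
      using \<open>i < length (s @ t)\<close> \<open>j < length (s @ t)\<close> by fastforce
    then show ?thesis
    proof cases
      case 1
      then show ?thesis using less by (simp add: nth_append)
    next
      case 2
      then show ?thesis using less_r'[of i "j - ?k"] st[of i "j - ?k"] by (simp add: nth_append)
    next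
      case 3
      then show ?thesis using less_r'[of j "i - ?k"] st[of j "i - ?k"] by (simp add: nth_append)
    next
      case 4
      then show ?thesis using less' by (simp add: nth_append)
    qed
  qed
  ultimately show "region_contains UNIV M (s @ t)"
    by (intro region_containsI[of _ ?c ?r] UNIV_I)
qed

text \<open>A dot of \<open>M\<close> to the lower right of a cell is dominated through
  \<open>Z\<close>, and that copy of \<open>t\<close> also dominates the cell. Hence new dots inside
  \<open>E\<close> dominate nothing new.\<close>

lemma dominated_Un:
  assumes "dominated t Z = E" "M \<subseteq> E"
  shows "dominated t (M \<union> Z) = E"
proof
  show "E \<subseteq> dominated t (M \<union> Z)" using assms dominated_mono by blast
  show "dominated t (M \<union> Z) \<subseteq> E"
  proof clarify
    fix r c assume "(r, c) \<in> dominated t (M \<union> Z)"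
    then have contains: "region_contains UNIV ((M \<union> Z) \<inter> {r<..} \<times> {c<..}) t" by (simp add: dominated_def)
    show "(r, c) \<in> E"
    proof (cases "M \<inter> {r<..} \<times> {c<..} = {}")
      case True
      then have "(M \<union> Z) \<inter> {r<..} \<times> {c<..} = Z \<inter> {r<..} \<times> {c<..}" by blast
      with contains have "(r, c) \<in> dominated t Z" by (simp add: dominated_def)
      then show ?thesis by (simp add: assms)
    next
      case False
      then obtain r' c' where "(r', c') \<in> E" "r < r'" "c < c'" using assms(2) by auto
      then show ?thesis using dominated_down[of r' c' t Z r c] assms(1) by simp
    qed
  qed
qed

text \<open>A dot of a copy of \<open>t\<close> that is itself dominated can be traded for a copy further to the right.\<close>

lemma dominated_Diff_dominated:
  assumes "finite M"
  shows "dominated t (M - dominated t M) = dominated t M"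
proof
  show "dominated t (M - dominated t M) \<subseteq> dominated t M" by (rule dominated_mono) blast
  have "(r, c) \<in> dominated t M \<Longrightarrow> (r, c) \<in> dominated t (M - dominated t M)" for r c
  proof (induction "card {d \<in> M. c < snd d}" arbitrary: r c rule: less_induct)
    case less
    have contains: "region_contains UNIV (M \<inter> {r<..} \<times> {c<..}) t"
      using less.prems by (simp add: dominated_def)
    show ?case
    proof (cases "dominated t M \<inter> (M \<inter> {r<..} \<times> {c<..}) = {}")
      case True
      then have "M \<inter> {r<..} \<times> {c<..} = (M - dominated t M) \<inter> {r<..} \<times> {c<..}" by blast
      with contains show ?thesis by (simp add: dominated_def)
    next
      case False
      then obtain r' c' where d: "(r', c') \<in> dominated t M" "(r', c') \<in> M" "r < r'" "c < c'" by auto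
      \<comment> \<open>The dot \<open>(r', c')\<close> itself is no longer counted, so the
        induction hypothesis applies to it; domination then passes to \<open>(r, c)\<close>, above
        and to the left.\<close>
      have "{d \<in> M. c' < snd d} \<subset> {d \<in> M. c < snd d}" using d by force
      then have "card {d \<in> M. c' < snd d} < card {d \<in> M. c < snd d}"
        using assms by (intro psubset_card_mono) auto
      from less.hyps[OF this d(1)] show ?thesis
        by (rule dominated_down) (use d in auto)
    qed
  qed
  then show "dominated t M \<subseteq> dominated t (M - dominated t M)" by auto
qed

lemma card_eq_if_fibres_eq:
  assumes "finite A"
    and fibres: "\<And>x. x \<in> A \<Longrightarrow> card {y \<in> A. f y = f x \<and> P y} = card {y \<in> A. f y = f x \<and> Q y}"
  shows "card {x \<in> A. P x} = card {x \<in> A. Q x}"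
proof -
  have *: "card {x \<in> A. P x} = (\<Sum>z \<in> f ` A. card {y \<in> A. f y = z \<and> P y})" for P
  proof -
    have "card {x \<in> A. P x} = (\<Sum>x \<in> A. if P x then 1 else 0)"
      using assms(1) by (simp add: sum.If_cases Int_def)
    also have "\<dots> = (\<Sum>z \<in> f ` A. \<Sum>y | y \<in> A \<and> f y = z. if P y then 1 else 0)"
      using assms(1) by (rule sum.image_gen)
    also have "\<dots> = (\<Sum>z \<in> f ` A. card {y \<in> A. f y = z \<and> P y})"
      using assms(1) by (simp add: sum.If_cases Int_def conj_ac)
    finally show ?thesis .
  qed
  show ?thesis unfolding *[of P] *[of Q] using fibres by (intro sum.cong) auto
qed

text \<open>Deleting the rows and columns of \<open>Z\<close> thus removes no dots but those of
  \<open>Z\<close>.\<close>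

lemma perfect_matching_lines:
  assumes M: "perfect_matching A B M" and "Z \<subseteq> M" "(a, b) \<in> M"
  shows "a \<in> fst ` Z \<longleftrightarrow> (a, b) \<in> Z" "b \<in> snd ` Z \<longleftrightarrow> (a, b) \<in> Z"
proof -
  show "a \<in> fst ` Z \<longleftrightarrow> (a, b) \<in> Z"
  proof
    assume "a \<in> fst ` Z"
    then obtain b' where "(a, b') \<in> Z" by auto
    then show "(a, b) \<in> Z"
      using perfect_matchingD(4)[OF M, of a b b'] assms(2,3) by auto
  qed force
  show "b \<in> snd ` Z \<longleftrightarrow> (a, b) \<in> Z"
  proof
    assume "b \<in> snd ` Z"
    then obtain a' where "(a', b) \<in> Z" by auto
    then show "(a, b) \<in> Z"
      using perfect_matchingD(3)[OF M, of a b a'] assms(2,3) by auto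
  qed force
qed

text \<open>Once the dominated cells \<open>E\<close> and the dots \<open>Z\<close> outside \<open>E\<close> are fixed, the dots in \<open>E\<close> can be
  rearranged freely.\<close>

lemma fibre_dominated:
  assumes M0: "perfect_matching {..<N} {..<N} M0"
    and E: "E = dominated t M0" and Z: "Z = M0 - E"
    and Y: "Y = E \<inter> ({..<N} - fst ` Z) \<times> ({..<N} - snd ` Z)"
  shows "{M. perfect_matching {..<N} {..<N} M \<and> dominated t M = E \<and> M - E = Z} =
     (\<lambda>M. M \<union> Z) ` placements Y"
proof (intro equalityI subsetI)
  have line_Y: "r \<in> fst ` Y \<Longrightarrow> r \<in> {..<N} - fst ` Z" "c \<in> snd ` Y \<Longrightarrow> c \<in> {..<N} - snd ` Z" for r c
    unfolding Y by (elim imageE IntE SigmaE; simp only: fst_conv snd_conv)+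
  fix M assume "M \<in> {M. perfect_matching {..<N} {..<N} M \<and> dominated t M = E \<and> M - E = Z}"
  then have M: "perfect_matching {..<N} {..<N} M" "dominated t M = E" "M - E = Z" by auto
  have sub: "M \<inter> E \<subseteq> Y"
  proof clarify
    fix r c assume rc: "(r, c) \<in> M" "(r, c) \<in> E"
    have "r \<notin> fst ` Z" "c \<notin> snd ` Z"
      using perfect_matching_lines[OF M(1), of Z] rc M(3) by blast+
    then show "(r, c) \<in> Y"
      using rc perfect_matchingD(1,2)[OF M(1)] unfolding Y by blast
  qed
  have "perfect_matching (fst ` Y) (snd ` Y) (M \<inter> E)"
  proof (rule perfect_matchingI)
    show "r \<in> fst ` Y \<and> c \<in> snd ` Y" if "(r, c) \<in> M \<inter> E" for r c
    proof -
      have "(r, c) \<in> Y" using that sub by blast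
      then show ?thesis by force
    qed
    show "\<exists>c. (r, c) \<in> M \<inter> E" if "r \<in> fst ` Y" for r
    proof -
      have r: "r < N" "r \<notin> fst ` Z" using line_Y(1)[OF that] by auto
      then obtain c where "(r, c) \<in> M" using perfect_matchingD(5)[OF M(1)] by auto
      then show ?thesis using r unfolding M(3)[symmetric] by force
    qed
    show "\<exists>r. (r, c) \<in> M \<inter> E" if "c \<in> snd ` Y" for c
    proof -
      have c: "c < N" "c \<notin> snd ` Z" using line_Y(2)[OF that] by auto
      then obtain r where "(r, c) \<in> M" using perfect_matchingD(6)[OF M(1)] by auto
      then show ?thesis using c unfolding M(3)[symmetric] by force
    qed
  qed (use perfect_matchingD(3,4)[OF M(1)] in blast)+
  with sub have "M \<inter> E \<in> placements Y" by (simp add: placements_def)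
  moreover have "M = (M \<inter> E) \<union> Z" using M(3) by blast
  ultimately show "M \<in> (\<lambda>M. M \<union> Z) ` placements Y" by blast
next
  fix M assume "M \<in> (\<lambda>M. M \<union> Z) ` placements Y"
  then obtain M' where M: "M = M' \<union> Z" and M': "perfect_matching (fst ` Y) (snd ` Y) M'" "M' \<subseteq> Y"
    by (auto simp: placements_def)
  have "finite M0" using M0 unfolding perfect_matching_def by (meson finite_SigmaI finite_lessThan finite_subset)
  then have "dominated t Z = E"
    unfolding Z E by (rule dominated_Diff_dominated)
  then have "dominated t M = E"
    unfolding M using M'(2) by (intro dominated_Un) (auto simp: Y)
  moreover have "M - E = Z"
    using M'(2) by (auto simp: M Y Z)
  moreover have "perfect_matching {..<N} {..<N} M"
  proof (rule perfect_matchingI)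
    have disj: "r \<notin> fst ` Z" "c \<notin> snd ` Z" if "(r, c) \<in> M'" for r c
      using that M'(2) by (auto simp: Y)
    have ZM0: "Z \<subseteq> M0" by (simp add: Z)
    show "r \<in> {..<N} \<and> c \<in> {..<N}" if "(r, c) \<in> M" for r c
      using that perfect_matchingD(1,2)[OF M0] ZM0 M'(2) unfolding M Y by blast
    show "r = r'" if rr': "(r, c) \<in> M" "(r', c) \<in> M" for r r' c
    proof -
      consider "(r, c) \<in> M'" "(r', c) \<in> M'" | "(r, c) \<in> M0" "(r', c) \<in> M0"
        using rr' disj(2) ZM0 unfolding M by (force intro: rev_image_eqI)
      then show ?thesis using perfect_matchingD(3)[OF M'(1)] perfect_matchingD(3)[OF M0] by cases
    qed
    show "c = c'" if cc': "(r, c) \<in> M" "(r, c') \<in> M" for r c c'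
    proof -
      consider "(r, c) \<in> M'" "(r, c') \<in> M'" | "(r, c) \<in> M0" "(r, c') \<in> M0"
        using cc' disj(1) ZM0 unfolding M by (force intro: rev_image_eqI)
      then show ?thesis using perfect_matchingD(4)[OF M'(1)] perfect_matchingD(4)[OF M0] by cases
    qed
    \<comment> \<open>The dots of \<open>M0\<close> outside \<open>Z\<close> witness that every line
      free of \<open>Z\<close> meets \<open>Y\<close>, so \<open>M'\<close> covers it.\<close>
    have rest: "r \<in> fst ` Y" "c \<in> snd ` Y" if "(r, c) \<in> M0" "(r, c) \<notin> Z" for r c
    proof -
      have "r \<notin> fst ` Z" "c \<notin> snd ` Z"
        using perfect_matching_lines[OF M0 ZM0] that by blast+
      then have "(r, c) \<in> Y"
        using that perfect_matchingD(1,2)[OF M0 that(1)] unfolding Y Z by blast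
      then show "r \<in> fst ` Y" "c \<in> snd ` Y" by (auto intro: rev_image_eqI)
    qed
    show "\<exists>c. (r, c) \<in> M" if "r \<in> {..<N}" for r
      using perfect_matchingD(5)[OF M0 that] rest(1) perfect_matchingD(5)[OF M'(1)] unfolding M by blast
    show "\<exists>r. (r, c) \<in> M" if "c \<in> {..<N}" for c
      using perfect_matchingD(6)[OF M0 that] rest(2) perfect_matchingD(6)[OF M'(1)] unfolding M by blast
  qed
  ultimately show "M \<in> {M. perfect_matching {..<N} {..<N} M \<and> dominated t M = E \<and> M - E = Z}" by blast
qed

text \<open>The dots of a copy of \<open>s\<close> with all crossing cells in \<open>E\<close> lie
  in \<open>E\<close> themselves, hence not in \<open>Z\<close>. The lines of the copy then avoid
  \<open>Z\<close>, and its crossing cells lie in \<open>Y\<close>.\<close>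

lemma card_fibre_dominated:
  assumes "perfect_matching {..<N} {..<N} M0"
    and E: "E = dominated t M0" and Z: "Z = M0 - E"
    and Y: "Y = E \<inter> ({..<N} - fst ` Z) \<times> ({..<N} - snd ` Z)"
  shows "card {M. perfect_matching {..<N} {..<N} M \<and> dominated t M = E \<and> M - E = Z \<and>
      \<not> region_contains (dominated t M) M s} =
    card {M \<in> placements Y. \<not> region_contains Y M s}"
proof -
  have contains: "region_contains E (M \<union> Z) s \<longleftrightarrow> region_contains Y M s" if "M \<in> placements Y" for M
  proof
    have M: "M \<subseteq> Y" using that by (simp add: placements_def)
    assume "region_contains E (M \<union> Z) s"
    then obtain r c where rc: "strict_mono_on {..<length s} c"
      "\<And>a. a < length s \<Longrightarrow> (r a, c a) \<in> M \<union> Z"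
      "\<And>a b. a < length s \<Longrightarrow> b < length s \<Longrightarrow> r a < r b \<longleftrightarrow> s ! a > s ! b"
      "\<And>a b. a < length s \<Longrightarrow> b < length s \<Longrightarrow> (r a, c b) \<in> E"
      by (rule region_containsE) blast
    have in_M: "(r a, c a) \<in> M" if "a < length s" for a
      using rc(2)[OF that] rc(4)[OF that that] by (auto simp: Z)
    have "(r a, c b) \<in> Y" if "a < length s" "b < length s" for a b
      using in_M[OF that(1)] in_M[OF that(2)] M rc(4)[OF that] unfolding Y by blast
    then show "region_contains Y M s"
      using rc in_M by (intro region_containsI[of _ c r])
  next
    assume "region_contains Y M s"
    then show "region_contains E (M \<union> Z) s"
      by (rule region_contains_mono) (auto simp: Y)
  qed
  have "{M. perfect_matching {..<N} {..<N} M \<and> dominated t M = E \<and> M - E = Z \<and>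
      \<not> region_contains (dominated t M) M s} =
    {M \<in> {M. perfect_matching {..<N} {..<N} M \<and> dominated t M = E \<and> M - E = Z}.
      \<not> region_contains E M s}" by auto
  also have "\<dots> = (\<lambda>M. M \<union> Z) ` {M \<in> placements Y. \<not> region_contains Y M s}"
    unfolding fibre_dominated[OF assms] using contains by blast
  also have "card \<dots> = card {M \<in> placements Y. \<not> region_contains Y M s}"
  proof (rule card_image, rule inj_onI)
    fix M M' assume *: "M \<in> {M \<in> placements Y. \<not> region_contains Y M s}"
      "M' \<in> {M \<in> placements Y. \<not> region_contains Y M s}" "M \<union> Z = M' \<union> Z"
    then have "M \<subseteq> E" "M' \<subseteq> E" by (auto simp: placements_def Y)
    moreover have "Z \<inter> E = {}" by (auto simp: Z)
    ultimately show "M = M'" using *(3) by blast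
  qed
  finally show ?thesis .
qed

text \<open>Permutations are classed by their dominated cells and the dots outside them. These data
  do not involve \<open>s\<close> or \<open>s'\<close>, and within a class both conditions concern
  placements in one and the same region, where the hypothesis applies.\<close>

theorem Wilf_equivalent_append:
  assumes eq: "\<And>Y. young_region Y \<Longrightarrow> card {M \<in> placements Y. \<not> region_contains Y M s} =
      card {M \<in> placements Y. \<not> region_contains Y M s'}"
    and "s \<noteq> []" "s' \<noteq> []"
    and gt: "\<forall>x \<in> set s. \<forall>y \<in> set t. y < x" "\<forall>x \<in> set s'. \<forall>y \<in> set t. y < x"
  shows "Wilf_equivalent (s @ t) (s' @ t)"
proof -
  have "card (perms_avoiding N (s @ t)) = card (perms_avoiding N (s' @ t))" for N
  proof -
    let ?A = "{M. perfect_matching {..<N} {..<N} M}"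
    have "?A \<subseteq> Pow ({..<N} \<times> {..<N})" by (auto simp: perfect_matching_def)
    then have "finite ?A" by (rule finite_subset) simp
    then have "card {M \<in> ?A. \<not> region_contains (dominated t M) M s} =
      card {M \<in> ?A. \<not> region_contains (dominated t M) M s'}"
    proof (rule card_eq_if_fibres_eq[where f = "\<lambda>M. (dominated t M, M - dominated t M)"])
      fix M0 assume M0: "M0 \<in> ?A"
      define E where "E = dominated t M0"
      define Z where "Z = M0 - E"
      define Y where "Y = E \<inter> ({..<N} - fst ` Z) \<times> ({..<N} - snd ` Z)"
      have "young_region Y"
        unfolding Y_def E_def by (rule young_region_Int) (auto intro: dominated_down)
      note fibre = card_fibre_dominated[OF _ E_def Z_def Y_def]
      have "{M \<in> ?A. (dominated t M, M - dominated t M) = (dominated t M0, M0 - dominated t M0) \<and>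
          \<not> region_contains (dominated t M) M u} =
        {M. perfect_matching {..<N} {..<N} M \<and> dominated t M = E \<and> M - E = Z \<and>
          \<not> region_contains (dominated t M) M u}" for u
        by (auto simp: E_def Z_def)
      then show "card {M \<in> ?A. (dominated t M, M - dominated t M) = (dominated t M0, M0 - dominated t M0) \<and>
          \<not> region_contains (dominated t M) M s} =
        card {M \<in> ?A. (dominated t M, M - dominated t M) = (dominated t M0, M0 - dominated t M0) \<and>
          \<not> region_contains (dominated t M) M s'}"
        using fibre[of s] fibre[of s'] M0 eq[OF \<open>young_region Y\<close>] by simp
    qed
    then show ?thesis
      using assms by (simp add: card_perms_avoiding region_contains_append)
  qed
  then show ?thesis by (simp add: Wilf_equivalent_def)
qed

theorem theorem1:
  "shape_Wilf_equivalent [2, 1, 3] [1, 3, 2] \<and>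
   (\<forall>n \<ge> 3. \<forall>\<tau> \<in> perms (n - 3).
      Wilf_equivalent ([n - 1, n - 2, n] @ \<tau>) ([n - 2, n, n - 1] @ \<tau>))"
proof (intro conjI allI impI ballI)
  show "shape_Wilf_equivalent [2, 1, 3] [1, 3, 2]"
    unfolding shape_Wilf_equivalent_def card_transversals_avoiding
    using card_placements_213_132[OF young_region_cells] by blast
next
  fix n :: nat and \<tau> assume "3 \<le> n" and \<tau>: "\<tau> \<in> perms (n - 3)"
  obtain m where n: "n = m + 3" using \<open>3 \<le> n\<close> by (metis add.commute le_iff_add)
  have less: "y < n - 2" if "y \<in> set \<tau>" for y
    using that permsD(3)[OF \<tau>] by auto
  show "Wilf_equivalent ([n - 1, n - 2, n] @ \<tau>) ([n - 2, n, n - 1] @ \<tau>)"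
  proof (rule Wilf_equivalent_append)
    fix Y assume Y: "young_region Y"
    \<comment> \<open>Only the relative order of the three entries matters, and
      \<open>n = m + 3\<close> keeps the truncated subtractions exact.\<close>
    have "region_contains Y M [n - 1, n - 2, n] \<longleftrightarrow> region_contains Y M [2, 1, 3]" for M
      using n by (simp add: region_contains_3)
    moreover have "region_contains Y M [n - 2, n, n - 1] \<longleftrightarrow> region_contains Y M [1, 3, 2]" for M
      using n by (simp add: region_contains_3)
    ultimately show "card {M \<in> placements Y. \<not> region_contains Y M [n - 1, n - 2, n]} =
        card {M \<in> placements Y. \<not> region_contains Y M [n - 2, n, n - 1]}"
      using card_placements_213_132[OF Y] by simp
  qed (use less in fastforce)+
qed

end
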